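(* Let $0<a_1<a_2<\cdots<a_\ell$ ($\ell\ge 1$) be integers with $\gcd(a_1,\dots,a_\ell)=1$, let $H=\langle a_1,\dots,a_\ell\rangle$ be the numerical semigroup they generate, and let $c=\mathrm{c}(H)$ be its conductor. Let $k$ be a field, $A=k[[H]]=k[[t^{a_1},\dots,t^{a_\ell}]]\subseteq k[[t]]$, and $\mathfrak m=(t^{a_1},\dots,t^{a_\ell})$ the maximal ideal of $A$. Suppose that $A$ is a Gorenstein ring. Let $q>0$ be an integer and assume that the following two conditions are satisfied: (i) $t^n\in\mathfrak m^q$ for all integers $n\ge c$; (ii) for every $n\in H$, if $t^n\notin\mathfrak m^{q-1}$, then $n<a_1(q-1)$. Let $0<s\in H$, and put $Q=(t^s)$ and $I=Q:\mathfrak m^q$. Then the following assertions hold. (1) $\mathfrak m^qI=\mathfrak m^qQ$ and $Q\cap I^2=QI$. (2) $I^2=QI$ if $s\ge c$. (3) $I^3=QI^2$ and the associated graded ring $\mathrm G(I)=\bigoplus_{n\ge0}I^n/I^{n+1}$ is Cohen-Macaulay, if $s\ge a_1(q-1)$.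
   Context: $\langle a_1,\dots,a_\ell\rangle=\{\sum_{i=1}^\ell\alpha_ia_i\mid 0\le\alpha_i\in\mathbb Z\}$. The conductor of $H$ is $\mathrm c(H)=\min\{m\in\mathbb Z\mid n\in H\text{ for all integers }n\ge m\}$. $k[[t]]$ is the formal power series ring in an indeterminate $t$; $Q:\mathfrak m^q=\{x\in A\mid \mathfrak m^qx\subseteq Q\}$; $\mathfrak m^0=A$. *)

theory Defs
  imports
    "HOL-Algebra.Ideal_Product"
    "HOL-Algebra.Ring_Divisibility"
    "HOL-Computational_Algebra.Formal_Power_Series"
    "HOL-Library.Extended_Nat"
begin

section \<open>Numerical semigroups and their semigroup rings\<close>

definition num_semigroup :: "(nat \<Rightarrow> nat) \<Rightarrow> nat \<Rightarrow> nat set" where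
  "num_semigroup a l = {(\<Sum>i=1..l. \<alpha> i * a i) |\<alpha>. True}"

(* The minimum over all integers m is the minimum over nat: no negative integer lies in H. *)
definition conductor :: "nat set \<Rightarrow> nat" where
  "conductor H = (LEAST m. \<forall>n\<ge>m. n \<in> H)"

(* k[[H]] is the subring of k[[t]] of the series whose support lies in H; t is fps_X. *)
definition semigroup_ring :: "nat set \<Rightarrow> ('k::field) fps ring" where
  "semigroup_ring H =
     \<lparr>carrier = {f. \<forall>n. fps_nth f n \<noteq> 0 \<longrightarrow> n \<in> H},
      monoid.mult = (*), one = 1, zero = 0, add = (+)\<rparr>"

section \<open>Ideals\<close>

(* HOL-Algebra's monoid of ideals under the ideal product; its unit is the unit ideal,
   so that the zeroth power of an ideal is the whole ring. *)
abbreviation ideal_pow :: "('a, 'b) ring_scheme \<Rightarrow> 'a set \<Rightarrow> nat \<Rightarrow> 'a set" where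
  "ideal_pow R I n \<equiv> I [^]\<^bsub>ideals_set R\<^esub> n"

definition colon_ideal :: "('a, 'b) ring_scheme \<Rightarrow> 'a set \<Rightarrow> 'a set \<Rightarrow> 'a set" where
  "colon_ideal R I J = {x \<in> carrier R. \<forall>y\<in>J. y \<otimes>\<^bsub>R\<^esub> x \<in> I}"

definition irreducible_ideal :: "('a, 'b) ring_scheme \<Rightarrow> 'a set \<Rightarrow> bool" where
  "irreducible_ideal R I \<longleftrightarrow> ideal I R \<and> I \<noteq> carrier R \<and>
     (\<forall>J K. ideal J R \<longrightarrow> ideal K R \<longrightarrow> I = J \<inter> K \<longrightarrow> I = J \<or> I = K)"

section \<open>Cohen-Macaulay and Gorenstein rings\<close>

definition ideal_height :: "('a, 'b) ring_scheme \<Rightarrow> 'a set \<Rightarrow> enat" where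
  "ideal_height R P =
     Sup {enat n |n. \<exists>p. (\<forall>i\<le>n. primeideal (p i) R) \<and> (\<forall>i<n. p i \<subset> p (Suc i)) \<and> p n = P}"

definition regular_sequence :: "('a, 'b) ring_scheme \<Rightarrow> 'a list \<Rightarrow> bool" where
  "regular_sequence R xs \<longleftrightarrow> set xs \<subseteq> carrier R \<and> Idl\<^bsub>R\<^esub> (set xs) \<noteq> carrier R \<and>
     (\<forall>i<length xs. \<forall>r\<in>carrier R.
        r \<otimes>\<^bsub>R\<^esub> (xs ! i) \<in> Idl\<^bsub>R\<^esub> (set (take i xs)) \<longrightarrow> r \<in> Idl\<^bsub>R\<^esub> (set (take i xs)))"

definition ideal_depth :: "('a, 'b) ring_scheme \<Rightarrow> 'a set \<Rightarrow> enat" where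
  "ideal_depth R P = Sup {enat (length xs) |xs. regular_sequence R xs \<and> set xs \<subseteq> P}"

(* Definition of Kaplansky (Commutative Rings, Section 3-1) and Eisenbud (Commutative Algebra,
   Section 18.2): depth and height agree at every maximal ideal. The ring need not be local. *)
definition cohen_macaulay :: "('a, 'b) ring_scheme \<Rightarrow> bool" where
  "cohen_macaulay R \<longleftrightarrow> cring R \<and> noetherian_ring R \<and>
     (\<forall>M. maximalideal M R \<longrightarrow> ideal_depth R M = ideal_height R M)"

definition local_ring :: "('a, 'b) ring_scheme \<Rightarrow> bool" where
  "local_ring R \<longleftrightarrow> cring R \<and> (\<exists>!M. maximalideal M R)"

definition max_ideal :: "('a, 'b) ring_scheme \<Rightarrow> 'a set" where
  "max_ideal R = (THE M. maximalideal M R)"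

(* For a Noetherian local ring R: dim R elements generating an ideal primary to the
   maximal ideal. *)
definition system_of_parameters :: "('a, 'b) ring_scheme \<Rightarrow> 'a list \<Rightarrow> bool" where
  "system_of_parameters R xs \<longleftrightarrow> set xs \<subseteq> max_ideal R \<and>
     enat (length xs) = ideal_height R (max_ideal R) \<and>
     (\<exists>n. ideal_pow R (max_ideal R) n \<subseteq> Idl\<^bsub>R\<^esub> (set xs))"

(* Classical definition for Noetherian local rings (cf. Bass, "On the ubiquity of Gorenstein
   rings"): Cohen-Macaulay, with an irreducible parameter ideal. In a Cohen-Macaulay local
   ring irreducibility of one parameter ideal is the same as irreducibility of all. *)
definition gorenstein_local :: "('a, 'b) ring_scheme \<Rightarrow> bool" where
  "gorenstein_local R \<longleftrightarrow> noetherian_ring R \<and> local_ring R \<and> cohen_macaulay R \<and>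
     (\<exists>xs. system_of_parameters R xs \<and> irreducible_ideal R (Idl\<^bsub>R\<^esub> (set xs)))"

section \<open>The associated graded ring\<close>

(* An element is a finitely supported sequence x whose n-th entry is a coset in I^n / I^(n+1),
   the coset I^(n+1) itself being zero. The n-th entry of a product is the coset of
   \<Sum>i\<le>n. u i * v (n - i) for representatives u i of x i and v j of y j; it is written as the set
   of all such sums plus elements of I^(n+1), which avoids choosing representatives. *)
definition assoc_graded :: "('a, 'b) ring_scheme \<Rightarrow> 'a set \<Rightarrow> (nat \<Rightarrow> 'a set) ring" where
  "assoc_graded R I =
     \<lparr>carrier = {x. (\<forall>n. \<exists>r\<in>ideal_pow R I n. x n = ideal_pow R I (Suc n) +>\<^bsub>R\<^esub> r) \<and>
                    finite {n. x n \<noteq> ideal_pow R I (Suc n)}},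
      monoid.mult = (\<lambda>x y n. {(\<Oplus>\<^bsub>R\<^esub>i\<in>{..n}. u i \<otimes>\<^bsub>R\<^esub> v (n - i)) \<oplus>\<^bsub>R\<^esub> w |u v w.
                         (\<forall>i\<le>n. u i \<in> x i \<and> v i \<in> y i) \<and> w \<in> ideal_pow R I (Suc n)}),
      one = (\<lambda>n. if n = 0 then ideal_pow R I 1 +>\<^bsub>R\<^esub> \<one>\<^bsub>R\<^esub> else ideal_pow R I (Suc n)),
      zero = (\<lambda>n. ideal_pow R I (Suc n)),
      add = (\<lambda>x y n. x n <+>\<^bsub>R\<^esub> y n)\<rparr>"

end

(* All ideals involved are monomial: m^q, Q and I consist of the power series with support in
   q(H - 0), s + H and E = {n in H. n + q(H - 0) is contained in s + H}, so that (1), (2) and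
   I^3 = QI^2 are statements about sums of subsets of H. They follow from the symmetry of H, which
   is what the Gorenstein property means for H, and the key fact is (E - s) + q(H - 0) <= q(H - 0).
   For the Cohen-Macaulay property, I^3 = QI^2 and Q Int I^2 = QI make t^s in degree 1 a
   nonzerodivisor T of G(I). Reading off the coefficient of t^(sn) in degree n gives a surjection
   from G(I) to k[T] with nilpotent kernel, and the polynomials in T are nonzerodivisors of G(I). *)

theory Submission
  imports Defs "HOL-Computational_Algebra.Polynomial" "HOL-Library.Set_Algebras"
begin

section \<open>Ideals of numerical semigroups\<close>

text \<open>An element s + d of E has d >= 0, but d may be a gap of H. Since d maps q(H - 0) into
  itself, so does every sum of such differences, and s plus such a sum belongs to E as soon as it
  lies in H. Membership in H is thus the only obstacle: for Q Int I^2 it is given, for s >= c it is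
  automatic, and for I^3 it comes from symmetry together with s >= a_1(q - 1), which by (ii) puts E
  into (q - 1)(H - 0). Two definitions shape the rest. The Gorenstein property supplies an
  irreducible parameter ideal whose generator need not be a monomial, so symmetry has to be
  extracted from an arbitrary power series. The Cohen-Macaulay property is demanded at all maximal
  ideals of G(I), not only at the homogeneous one. The comparison with k[T] treats them uniformly:
  every prime contains the nilpotent kernel, so the primes of G(I) are those of k[T], and height and
  depth are both 1.\<close>

lemma set_plus_iff: "x \<in> E + F \<longleftrightarrow> (\<exists>e\<in>E. \<exists>f\<in>F. x = e + f)"
  by (simp add: set_plus_def)

locale numerical_semigroup =
  fixes H :: "nat set" and c :: nat
  assumes zero_mem: "0 \<in> H"
    and add_mem: "x \<in> H \<Longrightarrow> y \<in> H \<Longrightarrow> x + y \<in> H"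
    and conductor_mem: "c \<le> n \<Longrightarrow> n \<in> H"
begin

text \<open>The empty set qualifies; it stands for the zero ideal of A.\<close>

definition sg_ideal :: "nat set \<Rightarrow> bool" where
  "sg_ideal E \<longleftrightarrow> E \<subseteq> H \<and> (\<forall>e\<in>E. \<forall>h\<in>H. e + h \<in> E)"

lemma sg_ideal_H: "sg_ideal H"
  by (auto simp: sg_ideal_def add_mem)

lemma sg_ideal_pos: "sg_ideal (H - {0})"
  by (auto simp: sg_ideal_def add_mem)

lemma sg_ideal_add:
  assumes "sg_ideal E" "sg_ideal F"
  shows "sg_ideal (E + F)"
  using assms add_mem unfolding sg_ideal_def
  by (fastforce simp: set_plus_iff add.assoc)

lemma sg_ideal_add_H: "sg_ideal E \<Longrightarrow> E + H = E"
  using zero_mem by (force simp: sg_ideal_def set_plus_iff)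

text \<open>The value H at 0 mirrors the zeroth power of an ideal being the whole ring; for an ideal
  E all powers are then ideals of H.\<close>

primrec sg_pow :: "nat set \<Rightarrow> nat \<Rightarrow> nat set" where
  "sg_pow E 0 = H"
| "sg_pow E (Suc n) = sg_pow E n + E"

lemma sg_ideal_pow: "sg_ideal E \<Longrightarrow> sg_ideal (sg_pow E n)"
  by (induction n) (auto intro: sg_ideal_H sg_ideal_add)

lemma sg_pow_subset: "sg_ideal E \<Longrightarrow> sg_pow E n \<subseteq> H"
  using sg_ideal_pow sg_ideal_def by blast

lemma sg_pow_add: "sg_ideal E \<Longrightarrow> sg_pow E m + sg_pow E n = sg_pow E (m + n)"
proof (induction n)
  case 0
  then show ?case by (simp add: sg_ideal_add_H sg_ideal_pow)
next
  case (Suc n)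
  then show ?case by (simp flip: add.assoc)
qed

lemma sg_pow_1: "sg_ideal E \<Longrightarrow> sg_pow E (Suc 0) = E"
  by (simp add: add.commute sg_ideal_add_H)

lemma sg_pow_Suc_subset: "sg_ideal E \<Longrightarrow> sg_pow E (Suc n) \<subseteq> sg_pow E n"
  using sg_ideal_pow[of E n] by (force simp: sg_ideal_def set_plus_iff)

lemma sg_pow_ge:
  assumes "\<And>e. e \<in> E \<Longrightarrow> b \<le> e" "n \<in> sg_pow E k"
  shows "b * k \<le> n"
  using assms(2)
proof (induction k arbitrary: n)
  case (Suc k)
  then obtain x e where "x \<in> sg_pow E k" "e \<in> E" "n = x + e" by (auto simp: set_plus_iff)
  with Suc.IH[of x] assms(1)[of e] show ?case by simp
qed simp

lemma sg_pow_mem: "e \<in> E \<Longrightarrow> e * n \<in> sg_pow E n"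
  by (induction n) (auto simp: zero_mem set_plus_iff add.commute)

end

text \<open>\<open>conductor_mem_pow\<close> and \<open>small_if_notin_pow\<close> are (i) and (ii)
  read off exponents, and \<open>a\<close> is a_1. Writing \<open>Suc n = c\<close> instead of n = c
  - 1 lets the case c = 0, where H has no gap, pass without truncated subtraction.\<close>

locale quasi_socle = numerical_semigroup +
  fixes a q s :: nat
  assumes frobenius_notin: "Suc n = c \<Longrightarrow> n \<notin> H"
    and symmetric: "n \<notin> H \<Longrightarrow> \<exists>h\<in>H. Suc (n + h) = c"
    and mult_le: "h \<in> H \<Longrightarrow> h \<noteq> 0 \<Longrightarrow> a \<le> h"
    and q_pos: "0 < q"
    and conductor_mem_pow: "c \<le> n \<Longrightarrow> n \<in> sg_pow (H - {0}) q"
    and small_if_notin_pow: "n \<in> H \<Longrightarrow> n \<notin> sg_pow (H - {0}) (q - 1) \<Longrightarrow> n < a * (q - 1)"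
    and s_pos: "0 < s" and s_mem: "s \<in> H"
begin

abbreviation Hq where "Hq \<equiv> sg_pow (H - {0}) q"

definition E where "E = {n \<in> H. \<forall>g\<in>Hq. \<exists>h\<in>H. n + g = s + h}"

lemma Hq_Suc: "Hq = sg_pow (H - {0}) (q - 1) + (H - {0})"
  using q_pos by (cases q) auto

lemma Hq_ideal: "sg_ideal Hq"
  by (intro sg_ideal_pow sg_ideal_pos)

lemma HqI: "g \<in> sg_pow (H - {0}) (q - 1) \<Longrightarrow> x \<in> H \<Longrightarrow> x \<noteq> 0 \<Longrightarrow> g + x \<in> Hq"
  unfolding Hq_Suc by (auto simp: set_plus_iff)

lemma Hq_add: "g \<in> Hq \<Longrightarrow> h \<in> H \<Longrightarrow> g + h \<in> Hq"
  using Hq_ideal by (auto simp: sg_ideal_def)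

lemma Hq_subset: "g \<in> Hq \<Longrightarrow> g \<in> H"
  using Hq_ideal by (auto simp: sg_ideal_def)

lemma E_ideal: "sg_ideal E"
proof -
  have "e + h \<in> E" if "e \<in> E" "h \<in> H" for e h
  proof -
    have "\<exists>h'\<in>H. e + h + g = s + h'" if "g \<in> Hq" for g
      using \<open>e \<in> E\<close> Hq_add[OF that \<open>h \<in> H\<close>] by (auto simp: E_def add_ac)
    then show ?thesis using that by (auto simp: E_def add_mem)
  qed
  then show ?thesis by (auto simp: sg_ideal_def E_def)
qed

lemma s_mem_E: "s \<in> E"
  by (auto simp: E_def s_mem Hq_subset)

lemma E_subset: "e \<in> E \<Longrightarrow> e \<in> H"
  by (simp add: E_def)

lemma E_add: "e \<in> E \<Longrightarrow> h \<in> H \<Longrightarrow> e + h \<in> E"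
  using E_ideal by (auto simp: sg_ideal_def)

text \<open>If n < s, the number g with n + g = s + c - 1 is at least c, hence in \<open>Hq\<close>
  by (i), and membership of n in E would put c - 1 into H. Every element of E thus has the form s +
  d with d \<ge> 0.\<close>

lemma E_ge:
  assumes "n \<in> E" shows "s \<le> n"
proof (rule ccontr)
  assume "\<not> s \<le> n"
  then have "c + s - 1 - n \<in> Hq" by (intro conductor_mem_pow) simp
  then obtain h where h: "h \<in> H" "n + (c + s - 1 - n) = s + h" using assms by (auto simp: E_def)
  with \<open>\<not> s \<le> n\<close> have "Suc h = c" by simp
  with h frobenius_notin show False by blast
qed

text \<open>With \<open>w\<close> the mirror image \<open>c - 1 - d\<close> of \<open>d \<notin> H\<close> and
  \<open>g = g' + x\<close>, either \<open>w - x\<close> lies in \<open>H\<close>, and hypothesis (ii) makes it so small that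
  \<open>d + g \<ge> c\<close>, or symmetry puts \<open>d + x\<close> into \<open>H\<close>.\<close>

lemma E_diff_add_Hq:
  assumes "s + d \<in> E" "g \<in> Hq"
  shows "d + g \<in> Hq"
proof (cases "d \<in> H")
  case True
  then show ?thesis using Hq_add[OF assms(2)] by (simp add: add.commute)
next
  case False
  then obtain w where w: "w \<in> H" "Suc (d + w) = c" using symmetric by blast
  \<comment> \<open>Otherwise \<open>s + d \<in> E\<close> would put d + w = c - 1 into H.\<close>
  have wq: "w \<notin> Hq"
  proof
    assume "w \<in> Hq"
    then obtain h where "h \<in> H" "s + d + w = s + h" using assms(1) by (auto simp: E_def)
    then show False using w frobenius_notin[of h] by simp
  qed
  obtain g' x where g: "g' \<in> sg_pow (H - {0}) (q - 1)" "x \<in> H" "x \<noteq> 0" "g = g' + x"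
    using assms(2) unfolding Hq_Suc by (auto simp: set_plus_iff)
  have g'_ge: "a * (q - 1) \<le> g'"
    using g(1) by (rule sg_pow_ge[rotated]) (simp add: mult_le)
  show ?thesis
  proof (cases "\<exists>w'\<in>H. w = w' + x")
    case True
    then obtain w' where w': "w' \<in> H" "w = w' + x" by blast
    then have "w' \<notin> sg_pow (H - {0}) (q - 1)" using wq HqI g by blast
    then have "w' < a * (q - 1)" using small_if_notin_pow w' by blast
    \<comment> \<open>d + g = (c - 1) + (g' - w'), where w' < a(q - 1) \<le> g'.\<close>
    then show ?thesis using g w w' g'_ge by (intro conductor_mem_pow) simp
  next
    case F: False
    have "d + x \<in> H"
    proof (cases "x \<le> w")
      case True
      then have "w - x \<notin> H" using F by (metis add.commute le_add_diff_inverse)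
      then obtain h where "h \<in> H" "Suc (w - x + h) = c" using symmetric by blast
      \<comment> \<open>The mirror image c - 1 - (w - x) is exactly d + x.\<close>
      moreover have "h = d + x" using True w calculation by simp
      ultimately show ?thesis by simp
    next
      case False
      then show ?thesis using w by (intro conductor_mem) simp
    qed
    then show ?thesis using HqI[OF g(1), of "d + x"] g by (simp add: add_ac)
  qed
qed

lemma E_obtain:
  assumes "e \<in> E" obtains d where "e = s + d" "s + d \<in> E"
  using E_ge[OF assms] assms by (metis le_add_diff_inverse)

lemma EI:
  assumes "n \<in> H" "\<And>g. g \<in> Hq \<Longrightarrow> \<exists>h\<in>H. n + g = s + h"
  shows "n \<in> E"
  using assms by (simp add: E_def)

text \<open>For e = s + d in E and g in \<open>Hq\<close>, the difference d is absorbed by g: g + e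
  = (d + g) + s.\<close>

lemma Hq_plus_E: "Hq + E = Hq + (({s} :: nat set) + H)"
proof
  show "Hq + E \<subseteq> Hq + ({s} + H)"
  proof
    fix x assume "x \<in> Hq + E"
    then obtain g e where "g \<in> Hq" "e \<in> E" "x = g + e" by (auto simp: set_plus_iff)
    moreover from \<open>e \<in> E\<close> obtain d where "e = s + d" "s + d \<in> E" by (rule E_obtain)
    ultimately have "x = (d + g) + (s + 0)" "d + g \<in> Hq" using E_diff_add_Hq by auto
    then show "x \<in> Hq + ({s} + H)" using zero_mem by (force simp: set_plus_iff)
  qed
  show "Hq + ({s} + H) \<subseteq> Hq + E"
    using s_mem_E E_add by (force simp: set_plus_iff)
qed

text \<open>Writing the two summands as s + d1 and s + d2 gives h = s + d1 + d2, and d1 and d2 both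
  map \<open>Hq\<close> into itself.\<close>

lemma shift_mem_E_plus_E:
  assumes "h \<in> H" "s + h \<in> E + E"
  shows "h \<in> E"
proof (rule EI[OF assms(1)])
  fix g assume g: "g \<in> Hq"
  obtain e1 e2 where e: "e1 \<in> E" "e2 \<in> E" "s + h = e1 + e2" using assms by (auto simp: set_plus_iff)
  from e(1) obtain d1 where d1: "e1 = s + d1" "s + d1 \<in> E" by (rule E_obtain)
  from e(2) obtain d2 where d2: "e2 = s + d2" "s + d2 \<in> E" by (rule E_obtain)
  have "d2 + (d1 + g) \<in> Hq" using E_diff_add_Hq d1 d2 g by blast
  moreover have "h + g = s + (d2 + (d1 + g))" using e d1 d2 by simp
  ultimately show "\<exists>h'\<in>H. h + g = s + h'" using Hq_subset by blast
qed

text \<open>Both summands are at least s, so x - s \<ge> s \<ge> c.\<close>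

lemma E_plus_E_if_large:
  assumes "c \<le> s" "x \<in> E + E"
  obtains h where "h \<in> H" "x = s + h"
proof -
  obtain e1 e2 where e: "e1 \<in> E" "e2 \<in> E" "x = e1 + e2" using assms by (auto simp: set_plus_iff)
  have "x = s + (x - s)" "x - s \<in> H" using e E_ge[of e1] E_ge[of e2] assms
    by (auto intro: conductor_mem)
  then show thesis using that by blast
qed

text \<open>With e_i = s + d_i, the number x - s = 2 s + d1 + d2 + d3 has to be split into two
  elements of E. If s + d1 + d2 lies in H, it lies in E, and e3 is the other one. Otherwise let y be
  its mirror image. The mirror image of d1 is then e2 + y and avoids \<open>Hq\<close>; but e2 is in
  (q - 1)(H - 0) by s \<ge> a(q - 1) and (ii), so y = 0. Hence s + d1 + d2 = c - 1, and any d3 > 0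
  lifts the sum beyond all gaps.\<close>

lemma E_pow_3:
  assumes "a * (q - 1) \<le> s"
  shows "E + E + E = {s} + (E + E)"
proof
  show "{s} + (E + E) \<subseteq> E + E + E"
    using s_mem_E by (force simp: set_plus_iff add_ac)
  show "E + E + E \<subseteq> {s} + (E + E)"
  proof
    fix x assume "x \<in> E + E + E"
    then obtain e1 e2 e3 where e: "e1 \<in> E" "e2 \<in> E" "e3 \<in> E" "x = e1 + e2 + e3"
      by (auto simp: set_plus_iff)
    from e(1) obtain d1 where d1: "e1 = s + d1" "s + d1 \<in> E" by (rule E_obtain)
    from e(2) obtain d2 where d2: "e2 = s + d2" "s + d2 \<in> E" by (rule E_obtain)
    from e(3) obtain d3 where d3: "e3 = s + d3" "s + d3 \<in> E" by (rule E_obtain)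
    have *: "x \<in> {s} + (E + E)" if "x = s + (u + v)" "u \<in> E" "v \<in> E" for u v
      using that by (force simp: set_plus_iff)
    consider "d1 \<in> H" | "d3 = 0" | "s + d1 + d2 \<in> H"
      | y where "d1 \<notin> H" "y \<in> H" "Suc (s + d1 + d2 + y) = c" "d3 \<noteq> 0"
      using symmetric by blast
    then show "x \<in> {s} + (E + E)"
    proof cases
      case 1
      then show ?thesis using e d1 E_add[of e2 d1] by (intro *[of "e2 + d1" e3]) simp_all
    next
      case 2
      then show ?thesis using e d3 by (intro *[of e1 e2]) simp_all
    next
      case 3
      have "s + d1 + d2 \<in> E"
      proof (rule EI[OF 3])
        fix g assume "g \<in> Hq"
        then have "d1 + (d2 + g) \<in> Hq" using E_diff_add_Hq d1 d2 by blast
        then show "\<exists>h\<in>H. s + d1 + d2 + g = s + h" using Hq_subset by (force simp: add_ac)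
      qed
      then show ?thesis using e d1 d2 by (intro *[of "s + d1 + d2" e3]) simp_all
    next
      case 4
      from \<open>d1 \<notin> H\<close> obtain w where w: "w \<in> H" "Suc (d1 + w) = c" using symmetric by blast
      have "w \<notin> Hq"
      proof
        assume "w \<in> Hq"
        then obtain h where "h \<in> H" "s + d1 + w = s + h" using d1 by (auto simp: E_def)
        then show False using w frobenius_notin[of h] by simp
      qed
      moreover have "w = e2 + y" using 4 w d2 by simp
      moreover have "e2 \<in> sg_pow (H - {0}) (q - 1)"
        using small_if_notin_pow[of e2] E_ge[OF e(2)] assms E_subset[OF e(2)] by linarith
      ultimately have "y = 0" using HqI 4(2) by blast
      then have large: "c \<le> s + d1 + d2 + d3" using 4 by simp
      have "s + d1 + d2 + d3 \<in> E"
      proof (rule EI)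
        show "s + d1 + d2 + d3 \<in> H" using large by (rule conductor_mem)
        fix g assume "g \<in> Hq"
        then have "d1 + (d2 + (d3 + g)) \<in> Hq" using E_diff_add_Hq d1 d2 d3 by blast
        then show "\<exists>h\<in>H. s + d1 + d2 + d3 + g = s + h" using Hq_subset by (force simp: add_ac)
      qed
      then show ?thesis using e d1 d2 d3 s_mem_E by (intro *[of s "s + d1 + d2 + d3"]) simp_all
    qed
  qed
qed

lemma E_pow_2: "sg_pow E 2 = E + E"
  by (simp add: numeral_2_eq_2 sg_pow_1[OF E_ideal, simplified])

lemma E_pow_Suc:
  assumes "a * (q - 1) \<le> s" "2 \<le> n"
  shows "sg_pow E (Suc n) = {s} + sg_pow E n"
  using assms(2)
proof (induction n rule: dec_induct)
  case base
  show ?case using E_pow_3[OF assms(1)] by (simp only: sg_pow.simps(2) E_pow_2)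
next
  case (step n)
  then show ?case by (simp add: add.assoc)
qed

text \<open>The nontrivial inclusion of the Valabrega-Valla condition Q Int I^(n+1) = Q I^n, on
  exponents. For n = 1 it is assertion (1), and from n = 2 on \<open>sg_pow E (Suc n)\<close> is a
  shift by s.\<close>

lemma shift_mem_E_pow:
  assumes "a * (q - 1) \<le> s" "h \<in> H" "s + h \<in> sg_pow E (Suc n)"
  shows "h \<in> sg_pow E n"
proof -
  consider "n = 0" | "n = 1" | "2 \<le> n" by linarith
  then show ?thesis
  proof cases
    case 2
    then show ?thesis using assms shift_mem_E_plus_E[of h] E_pow_2 sg_pow_1[OF E_ideal]
      by (simp add: numeral_2_eq_2)
  next
    case 3
    then have "s + h \<in> {s} + sg_pow E n" using assms(3) E_pow_Suc[OF assms(1)] by simp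
    then show ?thesis by (auto simp: set_plus_iff)
  qed (use assms in simp)
qed

end

section \<open>One-dimensional Cohen-Macaulay rings\<close>

lemma ideal_height_eq_1:
  assumes "primeideal N R" "primeideal M R" "N \<subset> M"
    and no_chain: "\<And>P P'. primeideal P R \<Longrightarrow> primeideal P' R \<Longrightarrow> P \<subset> P' \<Longrightarrow> P' \<subset> M \<Longrightarrow> False"
  shows "ideal_height R M = 1"
  unfolding ideal_height_def
proof (rule antisym)
  show "Sup {enat n |n. \<exists>p. (\<forall>i\<le>n. primeideal (p i) R) \<and> (\<forall>i<n. p i \<subset> p (Suc i)) \<and> p n = M} \<le> 1"
  proof (rule Sup_least, clarify)
    fix n p
    assume p: "\<forall>i\<le>n. primeideal (p i) R" "\<forall>i<n. p i \<subset> p (Suc i)" and M: "M = p n"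
    have "\<not> 2 \<le> n"
    proof
      assume "2 \<le> n"
      then obtain m where n: "n = Suc (Suc m)" by (metis One_nat_def Suc_1 Suc_le_D Suc_le_mono)
      show False using no_chain[of "p m" "p (Suc m)"] p M by (simp add: n)
    qed
    then show "enat n \<le> 1" by (simp add: one_enat_def)
  qed
  define p where "p = (\<lambda>i::nat. if i = 0 then N else M)"
  have "primeideal (p i) R" for i using assms by (simp add: p_def)
  moreover have "\<forall>i<1. p i \<subset> p (Suc i)" "p 1 = M" using assms by (simp_all add: p_def)
  ultimately have "enat 1 \<in> {enat n |n. \<exists>p. (\<forall>i\<le>n. primeideal (p i) R) \<and> (\<forall>i<n. p i \<subset> p (Suc i)) \<and> p n = M}"
    by blast
  then show "1 \<le> Sup {enat n |n. \<exists>p. (\<forall>i\<le>n. primeideal (p i) R) \<and> (\<forall>i<n. p i \<subset> p (Suc i)) \<and> p n = M}"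
    unfolding one_enat_def by (rule Sup_upper)
qed

lemma (in primeideal) nat_pow_mem_imp_mem:
  assumes "x \<in> carrier R" "x [^] (n::nat) \<in> I"
  shows "x \<in> I"
  using assms(2)
proof (induction n)
  case 0
  then show ?case using I_notcarr one_imp_carrier by simp
next
  case (Suc n)
  then show ?case using I_prime[of "x [^] n" x] assms(1) by auto
qed

text \<open>Governs the first entry of a regular sequence, where the preceding entries form the
  empty list.\<close>

lemma (in ring) genideal_empty: "Idl {} = {\<zero>}"
proof
  show "Idl {} \<subseteq> {\<zero>}" by (rule genideal_minimal[OF zeroideal]) simp
  show "{\<zero>} \<subseteq> Idl {}"
    using additive_subgroup.zero_closed[OF ideal.axioms(1)[OF genideal_ideal[of "{}"]]] by simp
qed

text \<open>Division with remainder by an element of least degree. The ideal is a plain set because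
  these polynomials form a type and not a ring with a carrier.\<close>

lemma poly_ideal_generator:
  fixes S :: "'k::field poly set"
  assumes "\<And>p q. p \<in> S \<Longrightarrow> q \<in> S \<Longrightarrow> p + q \<in> S" and "\<And>p r. p \<in> S \<Longrightarrow> r * p \<in> S"
    and "f \<in> S" "f \<noteq> 0"
  obtains g where "g \<in> S" "g \<noteq> 0" "\<And>p. p \<in> S \<Longrightarrow> g dvd p"
proof -
  obtain g where g: "g \<in> S" "g \<noteq> 0" "\<And>p. p \<in> S \<Longrightarrow> p \<noteq> 0 \<Longrightarrow> degree g \<le> degree p"
    using assms(3,4) ex_has_least_nat[of "\<lambda>p. p \<in> S \<and> p \<noteq> 0" f degree] by blast
  have "g dvd p" if "p \<in> S" for p
  proof -
    have "p mod g = p + (- (p div g)) * g" using minus_div_mult_eq_mod[of p g] by simp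
    then have "p mod g \<in> S" using assms(1,2) g(1) that by presburger
    then show ?thesis using degree_mod_less'[OF g(2)] g(3) by (metis mod_eq_0_iff_dvd not_le)
  qed
  then show thesis using that g by blast
qed

text \<open>A nonzero nonunit has positive degree, so each division by g lowers the degree.\<close>

lemma poly_split_power:
  fixes f g :: "'k::field poly"
  assumes "f \<noteq> 0" "\<not> g dvd 1" "g \<noteq> 0"
  obtains n h where "f = g ^ n * h" "\<not> g dvd h"
proof -
  have deg: "degree g > 0" using assms is_unit_iff_degree[of g] by simp
  have "\<exists>n h. f = g ^ n * h \<and> \<not> g dvd h" using assms(1)
  proof (induction "degree f" arbitrary: f rule: less_induct)
    case less
    show ?case
    proof (cases "g dvd f")
      case True
      then obtain f' where f': "f = g * f'" by blast
      then have "f' \<noteq> 0" using less.prems by auto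
      then have "degree f' < degree f" using deg assms(3) by (simp add: f' degree_mult_eq)
      then obtain n h where h: "f' = g ^ n * h" "\<not> g dvd h" using less.hyps \<open>f' \<noteq> 0\<close> by blast
      then have "f = g ^ Suc n * h" by (simp only: f' power_Suc mult.assoc)
      then show ?thesis using h(2) by blast
    next
      case False
      then show ?thesis by (intro exI[of _ 0] exI[of _ f]) simp
    qed
  qed
  then show thesis using that by blast
qed

text \<open>A ring which is \<open>k[T]\<close> up to nilpotents, and in which the nonzero elements of \<open>k[T]\<close>
  stay nonzerodivisors.\<close>

locale nilpotent_over_poly = cring R for R (structure) +
  fixes \<phi> :: "'a \<Rightarrow> 'k::field poly" and K :: nat
  assumes \<phi>_add: "x \<in> carrier R \<Longrightarrow> y \<in> carrier R \<Longrightarrow> \<phi> (x \<oplus> y) = \<phi> x + \<phi> y"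
    and \<phi>_mult: "x \<in> carrier R \<Longrightarrow> y \<in> carrier R \<Longrightarrow> \<phi> (x \<otimes> y) = \<phi> x * \<phi> y"
    and \<phi>_one: "\<phi> \<one> = 1"
    and \<phi>_lift: "p \<noteq> 0 \<Longrightarrow> \<exists>x\<in>carrier R. \<phi> x = p \<and> (\<forall>y\<in>carrier R. y \<otimes> x = \<zero> \<longrightarrow> y = \<zero>)"
    and ker_nilpotent: "x \<in> carrier R \<Longrightarrow> \<phi> x = 0 \<Longrightarrow> x [^] K = \<zero>"
begin

lemma \<phi>_zero [simp]: "\<phi> \<zero> = 0"
  using \<phi>_add[of \<zero> \<zero>] by (metis add_cancel_right_right l_zero zero_closed)

lemma diff_add_eq: "x \<in> carrier R \<Longrightarrow> y \<in> carrier R \<Longrightarrow> (x \<ominus> y) \<oplus> y = x"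
  by (simp add: a_assoc minus_eq l_neg)

lemma \<phi>_diff: "x \<in> carrier R \<Longrightarrow> y \<in> carrier R \<Longrightarrow> \<phi> (x \<ominus> y) = \<phi> x - \<phi> y"
  using \<phi>_add[of "x \<ominus> y" y] by (simp add: diff_add_eq)

lemma \<phi>_pow: "x \<in> carrier R \<Longrightarrow> \<phi> (x [^] (n::nat)) = \<phi> x ^ n"
  by (induction n) (auto simp: \<phi>_one \<phi>_mult mult.commute)

lemma one_not_zero: "\<one> \<noteq> \<zero>"
  using \<phi>_one \<phi>_zero by fastforce

lemma \<phi>_surj: obtains x where "x \<in> carrier R" "\<phi> x = p"
  using \<phi>_lift[of p] \<phi>_zero zero_closed by metis

lemma ker_subset_prime:
  assumes "primeideal P R" "x \<in> carrier R" "\<phi> x = 0"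
  shows "x \<in> P"
proof -
  interpret primeideal P R by fact
  show ?thesis using ker_nilpotent[OF assms(2,3)] nat_pow_mem_imp_mem[OF assms(2)] zero_closed by metis
qed

text \<open>P contains every nilpotent element and therefore the kernel of \<open>\<phi>\<close>; so
  P is the full preimage of its image in k[T].\<close>

lemma prime_mem_if_\<phi>_eq:
  assumes "primeideal P R" "x \<in> carrier R" "y \<in> P" "\<phi> x = \<phi> y"
  shows "x \<in> P"
proof -
  interpret primeideal P R by fact
  have y: "y \<in> carrier R" using assms(3) by (rule Icarr)
  have "\<phi> (x \<ominus> y) = 0" using \<phi>_diff[OF assms(2) y] assms(4) by simp
  then have "x \<ominus> y \<in> P" by (rule ker_subset_prime[OF assms(1) minus_closed[OF assms(2) y]])
  then have "(x \<ominus> y) \<oplus> y \<in> P" using assms(3) by (rule a_closed)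
  then show ?thesis using diff_add_eq[OF assms(2) y] by metis
qed

text \<open>The image of P is an ideal of k[T] with generator g; as P is its full preimage,
  primality passes to g.\<close>

lemma prime_generator:
  assumes "primeideal P R" "x \<in> P" "\<phi> x \<noteq> 0"
  obtains g where "g \<noteq> 0" "\<not> g dvd 1" "\<And>y. y \<in> carrier R \<Longrightarrow> y \<in> P \<longleftrightarrow> g dvd \<phi> y"
    "\<And>u v. g dvd u * v \<Longrightarrow> g dvd u \<or> g dvd v"
proof -
  interpret primeideal P R by fact
  have add: "p + p' \<in> \<phi> ` P" if "p \<in> \<phi> ` P" "p' \<in> \<phi> ` P" for p p'
  proof -
    from that(1) obtain y where y: "y \<in> P" "p = \<phi> y" by (elim imageE)
    from that(2) obtain y' where y': "y' \<in> P" "p' = \<phi> y'" by (elim imageE)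
    have "p + p' = \<phi> (y \<oplus> y')" using \<phi>_add[OF Icarr Icarr] y y' by simp
    then show ?thesis using imageI[OF a_closed[OF y(1) y'(1)]] by simp
  qed
  have mult: "r * p \<in> \<phi> ` P" if "p \<in> \<phi> ` P" for p r
  proof -
    obtain u where "u \<in> carrier R" "\<phi> u = r" by (rule \<phi>_surj)
    moreover from that obtain y where "y \<in> P" "p = \<phi> y" by (elim imageE)
    ultimately have "r * p = \<phi> (u \<otimes> y)" "u \<otimes> y \<in> P" using \<phi>_mult Icarr I_l_closed by auto
    then show ?thesis by (metis imageI)
  qed
  obtain g where g: "g \<in> \<phi> ` P" "g \<noteq> 0" "\<And>p. p \<in> \<phi> ` P \<Longrightarrow> g dvd p"
    using poly_ideal_generator[OF add mult imageI[OF assms(2)] assms(3)] by blast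
  have mem: "y \<in> P \<longleftrightarrow> g dvd \<phi> y" if "y \<in> carrier R" for y
  proof
    assume "g dvd \<phi> y"
    then obtain r where "\<phi> y = r * g" by (metis dvdE mult.commute)
    then have "\<phi> y \<in> \<phi> ` P" using mult g by simp
    then obtain z where "z \<in> P" "\<phi> y = \<phi> z" by (elim imageE)
    then show "y \<in> P" by (rule prime_mem_if_\<phi>_eq[OF assms(1) that])
  qed (use g(3) imageI in metis)
  have "\<not> g dvd 1" using mem[of \<one>] \<phi>_one I_notcarr one_imp_carrier by auto
  moreover have "g dvd u \<or> g dvd v" if "g dvd u * v" for u v
  proof -
    obtain x where x: "x \<in> carrier R" "\<phi> x = u" by (rule \<phi>_surj)
    obtain y where y: "y \<in> carrier R" "\<phi> y = v" by (rule \<phi>_surj)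
    have "x \<otimes> y \<in> P" using that x y mem \<phi>_mult by simp
    then show ?thesis using I_prime x y mem by blast
  qed
  ultimately show thesis using that[OF g(2)] mem by blast
qed

lemma ker_prime: "primeideal {x \<in> carrier R. \<phi> x = 0} R"
proof (rule primeidealI2)
  show "additive_subgroup {x \<in> carrier R. \<phi> x = 0} R"
  proof (intro additive_subgroup.intro add.subgroupI)
    show "\<ominus> x \<in> {x \<in> carrier R. \<phi> x = 0}" if "x \<in> {x \<in> carrier R. \<phi> x = 0}" for x
      using that \<phi>_diff[of \<zero> x] by (simp add: minus_eq)
  qed (use zero_closed \<phi>_zero in \<open>auto simp: \<phi>_add\<close>)
  show "carrier R \<noteq> {x \<in> carrier R. \<phi> x = 0}" using \<phi>_one one_closed by (metis (mono_tags, lifting) mem_Collect_eq zero_neq_one)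
qed (auto simp: \<phi>_mult is_cring)

text \<open>A maximal ideal inside the kernel would lie strictly below the preimage of the ideal
  (T), which is proper.\<close>

lemma maximal_not_in_ker:
  assumes "maximalideal M R"
  obtains x where "x \<in> M" "\<phi> x \<noteq> 0"
proof (rule ccontr)
  assume "\<not> thesis"
  interpret maximalideal M R by fact
  have ker: "\<phi> x = 0" if "x \<in> M" for x using that \<open>\<not> thesis\<close> \<open>\<And>x. x \<in> M \<Longrightarrow> \<phi> x \<noteq> 0 \<Longrightarrow> thesis\<close> by blast
  define J where "J = {x \<in> carrier R. [:0, 1:] dvd \<phi> x}"
  have "ideal J R"
  proof (intro idealI add.subgroupI)
    show "\<ominus> x \<in> J" if "x \<in> J" for x
      using that \<phi>_diff[of \<zero> x] by (simp add: minus_eq J_def)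
  qed (use zero_closed \<phi>_zero in \<open>auto simp: J_def \<phi>_add \<phi>_mult ring_axioms\<close>)
  moreover have "M \<subseteq> J" using ker Icarr by (auto simp: J_def)
  moreover have "J \<subseteq> carrier R" by (auto simp: J_def)
  ultimately have "J = M \<or> J = carrier R" by (rule I_maximal)
  moreover have "\<one> \<notin> J" using is_unit_iff_degree[of "[:0, 1 :: 'k:]"] by (simp add: J_def \<phi>_one)
  moreover have "J \<noteq> M"
  proof -
    obtain x where "x \<in> carrier R" "\<phi> x = [:0, 1:]" by (rule \<phi>_surj)
    then have "x \<in> J" "\<phi> x \<noteq> 0" by (simp_all add: J_def)
    then show ?thesis using ker[of x] by metis
  qed
  ultimately show False by blast
qed

text \<open>The kernel is a prime strictly below M. Nothing longer is possible: if P' and M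
  correspond to g and h, then P' \<subseteq> M means that h divides g, and as g is prime, either g
  divides h, whence P' = M, or h is a unit.\<close>

lemma height_maximal:
  assumes "maximalideal M R"
  shows "ideal_height R M = 1"
proof (rule ideal_height_eq_1[OF ker_prime])
  show M: "primeideal M R" using assms by (rule maximalideal_prime)
  obtain x where "x \<in> M" "\<phi> x \<noteq> 0" using maximal_not_in_ker[OF assms] .
  then show "{x \<in> carrier R. \<phi> x = 0} \<subset> M" using ker_subset_prime[OF M] by blast
next
  fix P P' assume P: "primeideal P R" and P': "primeideal P' R" and "P \<subset> P'" "P' \<subset> M"
  have M: "primeideal M R" using assms by (rule maximalideal_prime)
  interpret P': primeideal P' R by fact
  interpret M: primeideal M R by fact
  obtain x where x: "x \<in> P'" "x \<notin> P" using \<open>P \<subset> P'\<close> by blast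
  then have "\<phi> x \<noteq> 0" using ker_subset_prime[OF P] P'.Icarr by blast
  obtain g where g: "g \<noteq> 0" "\<And>y. y \<in> carrier R \<Longrightarrow> y \<in> P' \<longleftrightarrow> g dvd \<phi> y"
    "\<And>u v. g dvd u * v \<Longrightarrow> g dvd u \<or> g dvd v"
    using prime_generator[OF P' x(1) \<open>\<phi> x \<noteq> 0\<close>] by metis
  have "x \<in> M" using x \<open>P' \<subset> M\<close> by blast
  then obtain h where h: "\<not> h dvd 1" "\<And>y. y \<in> carrier R \<Longrightarrow> y \<in> M \<longleftrightarrow> h dvd \<phi> y"
    using prime_generator[OF M _ \<open>\<phi> x \<noteq> 0\<close>] by metis
  obtain z where z: "z \<in> carrier R" "\<phi> z = g" by (rule \<phi>_surj)
  then have "z \<in> M" using g(2)[of z] \<open>P' \<subset> M\<close> by auto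
  then obtain e where e: "g = h * e" using h(2) z by blast
  then consider "g dvd h" | "g dvd e" using g(3)[of h e] by auto
  then show False
  proof cases
    case 1
    then have "M \<subseteq> P'" using g(2) h(2) M.Icarr by (meson dvd_trans subsetI)
    then show False using \<open>P' \<subset> M\<close> by blast
  next
    case 2
    then obtain e' where "e = g * e'" by blast
    with e have "g * 1 = g * (h * e')" by simp
    then have "1 = h * e'" using g(1) by (simp only: mult_cancel_left) simp
    then show False using h(1) by (metis dvd_triv_left)
  qed
qed

lemma nonzerodivisor_not_in_ker:
  assumes "x \<in> carrier R" "\<And>y. y \<in> carrier R \<Longrightarrow> y \<otimes> x = \<zero> \<Longrightarrow> y = \<zero>"
  shows "\<phi> x \<noteq> 0"
proof
  assume "\<phi> x = 0"
  have "x [^] n \<noteq> \<zero>" for n :: nat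
    by (induction n) (use assms one_not_zero in auto)
  then show False using ker_nilpotent[OF assms(1) \<open>\<phi> x = 0\<close>] by blast
qed

text \<open>Suppose x, y is regular in M, and M corresponds to g. Write \<open>\<phi> x\<close> =
  g^n h with g not dividing h, and \<open>\<phi> y\<close> = g y'. With lifts u of h and v of y'^n,
  the elements u y^n and v x have the same image, so they differ by a nilpotent element. A power of
  u y^n is then a multiple of x; y being regular modulo x, a power of u lies in (x) \<subseteq> M.
  Hence g divides h, a contradiction.\<close>

lemma regular_sequence_length_le_1:
  assumes "maximalideal M R" "regular_sequence R xs" "set xs \<subseteq> M"
  shows "length xs \<le> 1"
proof (rule ccontr)
  assume "\<not> length xs \<le> 1"
  have M: "primeideal M R" using assms(1) by (rule maximalideal_prime)
  interpret M: primeideal M R by fact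
  obtain x y ys where xs: "xs = x # y # ys"
    using \<open>\<not> length xs \<le> 1\<close> by (cases xs; cases "tl xs") auto
  have x: "x \<in> M" "x \<in> carrier R" and y: "y \<in> M" "y \<in> carrier R"
    using assms M.Icarr by (auto simp: xs)
  interpret Ix: ideal "PIdl x" R using x by (intro cgenideal_ideal)
  have reg: "r \<otimes> (xs ! i) \<in> Idl (set (take i xs)) \<Longrightarrow> r \<in> Idl (set (take i xs))"
    if "i < length xs" "r \<in> carrier R" for i r
    using assms(2) that unfolding regular_sequence_def by blast
  have "r = \<zero>" if "r \<in> carrier R" "r \<otimes> x = \<zero>" for r
    using reg[of 0 r] that by (simp add: xs genideal_empty)
  then have "\<phi> x \<noteq> 0" using nonzerodivisor_not_in_ker x by blast
  have reg_y: "r \<in> PIdl x" if "r \<in> carrier R" "r \<otimes> y \<in> PIdl x" for r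
    using reg[of 1 r] that x by (simp add: xs cgenideal_eq_genideal)
  have reg_y_pow: "r \<in> PIdl x" if "r \<in> carrier R" "r \<otimes> y [^] n \<in> PIdl x" for r and n :: nat
    using that(2)
  proof (induction n)
    case (Suc n)
    then have "(r \<otimes> y [^] n) \<otimes> y \<in> PIdl x" using that y by (simp add: m_assoc)
    then show ?case using Suc.IH reg_y[of "r \<otimes> y [^] n"] that y by simp
  qed (use that in simp)
  obtain g where g: "g \<noteq> 0" "\<not> g dvd 1" "\<And>y. y \<in> carrier R \<Longrightarrow> y \<in> M \<longleftrightarrow> g dvd \<phi> y"
    using prime_generator[OF M x(1) \<open>\<phi> x \<noteq> 0\<close>] by metis
  obtain n h where h: "\<phi> x = g ^ n * h" "\<not> g dvd h"
    by (rule poly_split_power[OF \<open>\<phi> x \<noteq> 0\<close> g(2,1)])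
  obtain y' where y': "\<phi> y = g * y'" using g(3) y by blast
  obtain u where u: "u \<in> carrier R" "\<phi> u = h" by (rule \<phi>_surj)
  obtain v where v: "v \<in> carrier R" "\<phi> v = y' ^ n" by (rule \<phi>_surj)
  define z where "z = u \<otimes> y [^] n"
  have z: "z \<in> carrier R" by (simp add: z_def u y)
  have "\<phi> (z \<ominus> v \<otimes> x) = 0"
    using u v x y z by (simp add: \<phi>_diff \<phi>_mult \<phi>_pow z_def h y' power_mult_distrib mult_ac)
  then have nil: "(z \<ominus> v \<otimes> x) [^] K = \<zero>"
    by (rule ker_nilpotent[OF minus_closed[OF z m_closed[OF v(1) x(2)]]])
  have vx: "v \<otimes> x \<in> PIdl x" by (rule Ix.I_l_closed[OF cgenideal_self[OF x(2)] v(1)])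
  \<comment> \<open>z and z - v x are congruent modulo x, hence so are their powers; for m = K the
    second power vanishes.\<close>
  have "z [^] m \<ominus> (z \<ominus> v \<otimes> x) [^] m \<in> PIdl x" for m :: nat
  proof (induction m)
    case 0
    then show ?case by (simp add: minus_eq r_neg)
  next
    case (Suc m)
    define w where "w = z \<ominus> v \<otimes> x"
    have w: "w \<in> carrier R" using z v x by (simp add: w_def)
    have eq: "z [^] Suc m \<ominus> w [^] Suc m = (z [^] m \<ominus> w [^] m) \<otimes> w \<oplus> z [^] m \<otimes> (v \<otimes> x)"
    proof -
      have "z = w \<oplus> v \<otimes> x" using z v x by (simp add: w_def diff_add_eq)
      then have "z [^] Suc m = z [^] m \<otimes> w \<oplus> z [^] m \<otimes> (v \<otimes> x)"
        using z w v x by (simp add: r_distr)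
      moreover have "(z [^] m \<ominus> w [^] m) \<otimes> w = z [^] m \<otimes> w \<ominus> w [^] Suc m"
        using z w by (simp add: minus_eq l_distr l_minus)
      ultimately show ?thesis using z w v x by (simp add: minus_eq a_ac)
    qed
    have "(z [^] m \<ominus> w [^] m) \<otimes> w \<in> PIdl x"
      using Suc.IH w unfolding w_def[symmetric] by (rule Ix.I_r_closed)
    moreover have "z [^] m \<otimes> (v \<otimes> x) \<in> PIdl x"
      by (rule Ix.I_l_closed[OF vx nat_pow_closed[OF z]])
    ultimately have "z [^] Suc m \<ominus> w [^] Suc m \<in> PIdl x"
      unfolding eq by (rule Ix.a_closed)
    then show ?case unfolding w_def .
  qed
  from this[of K] have "z [^] K \<in> PIdl x" using nil z by (simp add: minus_eq)
  then have "u [^] K \<otimes> (y [^] n) [^] K \<in> PIdl x" using u y by (simp add: z_def nat_pow_distrib)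
  then have "u [^] K \<in> PIdl x" using reg_y_pow[of "u [^] K" "n * K"] u y by (simp add: nat_pow_pow)
  moreover have "PIdl x \<subseteq> M" using x M.is_ideal by (intro cgenideal_minimal)
  ultimately have "u \<in> M" using M.nat_pow_mem_imp_mem[OF u(1) subsetD] by metis
  then show False using g(3)[OF u(1)] u(2) h(2) by simp
qed

lemma depth_maximal:
  assumes "maximalideal M R"
  shows "ideal_depth R M = 1"
  unfolding ideal_depth_def
proof (rule antisym)
  show "Sup {enat (length xs) |xs. regular_sequence R xs \<and> set xs \<subseteq> M} \<le> 1"
    using regular_sequence_length_le_1[OF assms] by (intro Sup_least) (auto simp: one_enat_def)
  interpret maximalideal M R by fact
  obtain x where x: "x \<in> M" "\<phi> x \<noteq> 0" using maximal_not_in_ker[OF assms] .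
  \<comment> \<open>x itself may be a zero divisor, so it is replaced by a nonzerodivisor with the
    same image, which again lies in M.\<close>
  obtain y where y: "y \<in> carrier R" "\<phi> y = \<phi> x" "\<And>z. z \<in> carrier R \<Longrightarrow> z \<otimes> y = \<zero> \<Longrightarrow> z = \<zero>"
    using \<phi>_lift[OF x(2)] by metis
  have "y \<in> M" using prime_mem_if_\<phi>_eq[OF maximalideal_prime[OF assms] y(1) x(1) y(2)] .
  then have "Idl {y} \<subseteq> M" by (intro genideal_minimal[OF is_ideal]) simp
  then have "Idl {y} \<noteq> carrier R" using I_notcarr a_subset by blast
  then have "regular_sequence R [y]"
    using y by (auto simp: regular_sequence_def genideal_empty)
  then show "1 \<le> Sup {enat (length xs) |xs. regular_sequence R xs \<and> set xs \<subseteq> M}"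
    using \<open>y \<in> M\<close> by (intro Sup_upper) (force simp: one_enat_def intro!: exI[of _ "[y]"])
qed

theorem cohen_macaulay: "noetherian_ring R \<Longrightarrow> cohen_macaulay R"
  by (simp add: cohen_macaulay_def is_cring depth_maximal height_maximal)

end

section \<open>Monomial ideals of semigroup rings\<close>

text \<open>S is not confined to H, since \<open>insert n H\<close> for a gap n occurs as
  well.\<close>

definition supp_on :: "nat set \<Rightarrow> 'k::field fps set" where
  "supp_on S = {f. \<forall>n. fps_nth f n \<noteq> 0 \<longrightarrow> n \<in> S}"

lemma semigroup_ring_simps [simp]:
  "carrier (semigroup_ring H) = supp_on H"
  "x \<otimes>\<^bsub>semigroup_ring H\<^esub> y = x * y"
  "x \<oplus>\<^bsub>semigroup_ring H\<^esub> y = x + y"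
  "\<one>\<^bsub>semigroup_ring H\<^esub> = 1"
  "\<zero>\<^bsub>semigroup_ring H\<^esub> = 0"
  by (simp_all add: semigroup_ring_def supp_on_def)

lemma supp_onI: "(\<And>n. fps_nth f n \<noteq> 0 \<Longrightarrow> n \<in> S) \<Longrightarrow> f \<in> supp_on S"
  by (simp add: supp_on_def)

lemma supp_onD: "f \<in> supp_on S \<Longrightarrow> n \<notin> S \<Longrightarrow> fps_nth f n = 0"
  by (auto simp: supp_on_def)

lemma supp_on_mono: "S \<subseteq> T \<Longrightarrow> supp_on S \<subseteq> supp_on T"
  by (auto simp: supp_on_def)

lemma supp_on_Int: "supp_on S \<inter> supp_on T = supp_on (S \<inter> T)"
  by (auto simp: supp_on_def)

lemma supp_on_zero [simp]: "0 \<in> supp_on S"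
  by (simp add: supp_on_def)

lemma supp_on_add: "f \<in> supp_on S \<Longrightarrow> g \<in> supp_on S \<Longrightarrow> f + g \<in> supp_on S"
  by (auto simp: supp_on_def) (metis add.right_neutral)

lemma supp_on_uminus: "f \<in> supp_on S \<Longrightarrow> - f \<in> supp_on S"
  by (simp add: supp_on_def)

lemma supp_on_diff: "f \<in> supp_on S \<Longrightarrow> g \<in> supp_on S \<Longrightarrow> f - g \<in> supp_on S"
  using supp_on_add[of f S "- g"] supp_on_uminus[of g S] by simp

lemma supp_on_sum: "(\<And>i. i \<in> I \<Longrightarrow> f i \<in> supp_on S) \<Longrightarrow> (\<Sum>i\<in>I. f i) \<in> supp_on S"
  by (induction I rule: infinite_finite_induct) (auto intro: supp_on_add)

lemma supp_on_mult:
  assumes "f \<in> supp_on S" "g \<in> supp_on T"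
  shows "f * g \<in> supp_on (S + T)"
proof (rule supp_onI)
  fix n assume "fps_nth (f * g) n \<noteq> 0"
  then obtain i where i: "i \<in> {0..n}" "fps_nth f i * fps_nth g (n - i) \<noteq> 0"
    unfolding fps_mult_nth by (meson sum.not_neutral_contains_not_neutral)
  then have "i \<in> S" "n - i \<in> T" "n = i + (n - i)" using assms by (auto simp: supp_on_def)
  then show "n \<in> S + T" by (auto simp: set_plus_iff)
qed

lemma supp_on_const_mult: "f \<in> supp_on S \<Longrightarrow> fps_const a * f \<in> supp_on S"
  by (simp add: supp_on_def)

lemma X_power_mem_supp_on [simp]: "fps_X ^ n \<in> supp_on S \<longleftrightarrow> n \<in> S"
  by (auto simp: supp_on_def fps_X_power_nth)

lemma X_power_mult_mem_supp_on: "fps_X ^ n * f \<in> supp_on ({n} + S) \<longleftrightarrow> f \<in> supp_on S"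
proof
  assume L: "fps_X ^ n * f \<in> supp_on ({n} + S)"
  show "f \<in> supp_on S"
  proof (rule supp_onI)
    fix m assume "fps_nth f m \<noteq> 0"
    then have "fps_nth (fps_X ^ n * f) (n + m) \<noteq> 0" by (simp add: fps_X_power_mult_nth)
    then have "n + m \<in> {n} + S" using L by (auto simp: supp_on_def)
    then show "m \<in> S" by (auto simp: set_plus_iff)
  qed
qed (simp add: supp_on_mult)

lemma X_power_dvd_if_supp_ge:
  assumes "\<And>i. fps_nth f i \<noteq> 0 \<Longrightarrow> n \<le> i"
  obtains g where "f = fps_X ^ n * g"
proof
  show "f = fps_X ^ n * fps_shift n f"
  proof (rule fps_ext)
    show "fps_nth f m = fps_nth (fps_X ^ n * fps_shift n f) m" for m
      using assms[of m] by (cases "fps_nth f m = 0") (auto simp: fps_X_power_mult_nth)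
  qed
qed

lemma supp_on_shift:
  assumes "f \<in> supp_on ({n} + S)"
  obtains g where "g \<in> supp_on S" "f = fps_X ^ n * g"
proof -
  obtain g where g: "f = fps_X ^ n * g"
    using assms by (rule_tac X_power_dvd_if_supp_ge[of f n]) (auto simp: supp_on_def set_plus_iff)
  then show thesis using that assms X_power_mult_mem_supp_on[of n g S] by simp
qed

section \<open>The ring A and its ideals given by exponent sets\<close>

context numerical_semigroup
begin

abbreviation A :: "'k::field fps ring" where
  "A \<equiv> semigroup_ring H"

lemma H_add_H: "H + H = H"
  by (rule sg_ideal_add_H[OF sg_ideal_H])

lemma supp_on_H_mult: "f \<in> supp_on H \<Longrightarrow> g \<in> supp_on H \<Longrightarrow> f * g \<in> supp_on H"
  using supp_on_mult[of f H g H] by (simp add: H_add_H)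

lemma supp_on_H_one: "1 \<in> supp_on H"
  using X_power_mem_supp_on[of 0 H] by (simp add: zero_mem)

text \<open>t^c k[[t]] is contained in A, so multiplication by t^c turns arbitrary power series,
  such as inverses of units, into elements of A.\<close>

lemma supp_on_H_large: "fps_X ^ c * f \<in> supp_on H"
  by (rule supp_onI) (auto simp: fps_X_power_mult_nth conductor_mem split: if_splits)

lemma cring_A: "cring (A :: 'k::field fps ring)"
proof (rule cringI)
  show "abelian_group (A :: 'k fps ring)"
  proof (rule abelian_groupI)
    show "\<exists>y\<in>carrier A. y \<oplus>\<^bsub>A\<^esub> x = \<zero>\<^bsub>A\<^esub>" if "x \<in> carrier A" for x :: "'k fps"
      using that by (intro bexI[of _ "- x"]) (auto simp: supp_on_uminus)
  qed (auto simp: supp_on_add add_ac)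
  show "comm_monoid (A :: 'k fps ring)"
    by (rule comm_monoidI) (auto simp: supp_on_H_mult supp_on_H_one mult_ac)
qed (auto simp: algebra_simps)

lemma domain_A: "domain (A :: 'k::field fps ring)"
  by (rule domain.intro[OF cring_A]) (simp add: domain_axioms_def)

lemma A_a_inv: "f \<in> supp_on H \<Longrightarrow> \<ominus>\<^bsub>A\<^esub> f = - f"
proof -
  assume f: "f \<in> supp_on H"
  interpret cring A by (rule cring_A)
  show ?thesis using f minus_equality[of "- f" f] by (simp add: supp_on_uminus)
qed

lemma A_minus: "f \<in> supp_on H \<Longrightarrow> g \<in> supp_on H \<Longrightarrow> f \<ominus>\<^bsub>A\<^esub> g = f - g"
  by (simp add: a_minus_def A_a_inv)

lemma A_nat_pow: "f [^]\<^bsub>A\<^esub> n = f ^ n"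
  by (induction n) (simp_all add: nat_pow_def)

lemma ideal_AI:
  assumes "J \<subseteq> supp_on H" "0 \<in> J" "\<And>f g. f \<in> J \<Longrightarrow> g \<in> J \<Longrightarrow> f + g \<in> J"
    and "\<And>f g. f \<in> J \<Longrightarrow> g \<in> supp_on H \<Longrightarrow> f * g \<in> J"
  shows "ideal J (A :: 'k::field fps ring)"
proof -
  interpret cring "A :: 'k fps ring" by (rule cring_A)
  have "- f \<in> J" if "f \<in> J" for f
    using assms(4)[OF that supp_on_uminus[OF supp_on_H_one]] by simp
  then have "\<ominus>\<^bsub>A\<^esub> f \<in> J" if "f \<in> J" for f
    using that assms(1) A_a_inv[of f] by auto
  then show ?thesis
    using assms by (intro idealI ring_axioms add.subgroupI) (auto simp: mult.commute)
qed

lemma ideal_supp_on: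
  assumes "sg_ideal E"
  shows "ideal (supp_on E) (A :: 'k::field fps ring)"
proof (rule ideal_AI)
  show "supp_on E \<subseteq> (supp_on H :: 'k fps set)"
    using assms by (intro supp_on_mono) (simp add: sg_ideal_def)
  show "f * g \<in> supp_on E" if "f \<in> supp_on E" "g \<in> supp_on H" for f g :: "'k fps"
    using supp_on_mult[OF that] by (simp add: sg_ideal_add_H[OF assms])
qed (auto simp: supp_on_add)

text \<open>The tail of a power series beyond \<open>m + c\<close> is a multiple of \<open>t^m\<close>, so that only
  finitely many monomials have to be treated separately.\<close>

lemma supp_on_subset_ideal:
  assumes J: "ideal J (A :: 'k::field fps ring)" and "S \<subseteq> H" and mono: "\<And>n. n \<in> S \<Longrightarrow> fps_X ^ n \<in> J"
  shows "supp_on S \<subseteq> J"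
proof
  fix f :: "'k fps" assume f: "f \<in> supp_on S"
  interpret ideal J "A :: 'k fps ring" by fact
  have J_add: "g + h \<in> J" if "g \<in> J" "h \<in> J" for g h
    using additive_subgroup.a_closed[OF is_additive_subgroup that] by simp
  have J_mult: "g * h \<in> J" if "g \<in> J" "h \<in> supp_on H" for g h using I_r_closed[of g h] that by simp
  have J_zero: "0 \<in> J" using additive_subgroup.zero_closed[OF is_additive_subgroup] by simp
  show "f \<in> J"
  proof (cases "S = {}")
    case True
    then have "f = 0" using f by (auto simp: supp_on_def fps_eq_iff)
    then show ?thesis using J_zero by simp
  next
    case False
    then obtain m where m: "m \<in> S" by blast
    have cut: "fps_cutoff n f \<in> J" for n
    proof (induction n)
      case 0
      then show ?case using J_zero by simp
    next
      case (Suc n)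
      have eq: "fps_cutoff (Suc n) f = fps_cutoff n f + fps_X ^ n * fps_const (fps_nth f n)"
        by (rule fps_ext) (auto simp: fps_X_power_mult_nth less_Suc_eq)
      have "fps_X ^ n * fps_const (fps_nth f n) \<in> J"
      proof (cases "n \<in> S")
        case True
        have "fps_const (fps_nth f n) \<in> supp_on H"
          using supp_on_const_mult[OF supp_on_H_one] by simp
        then show ?thesis using J_mult mono[OF True] by blast
      next
        case False
        then show ?thesis using supp_onD[OF f] J_zero by simp
      qed
      then show ?case unfolding eq using Suc.IH by (intro J_add)
    qed
    have "f = fps_cutoff (m + c) f + fps_X ^ m * (fps_X ^ c * fps_shift (m + c) f)"
      by (rule fps_ext) (auto simp: fps_X_power_mult_nth)
    moreover have "fps_X ^ m * (fps_X ^ c * fps_shift (m + c) f) \<in> J"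
      by (rule J_mult[OF mono[OF m] supp_on_H_large])
    ultimately show ?thesis using J_add[OF cut[of "m + c"]] by metis
  qed
qed

text \<open>The ideal product consists of finite sums of products, whereas
  \<open>supp_on (E + F)\<close> may contain infinite series; \<open>supp_on_subset_ideal\<close>
  reduces the claim to the monomials t^(e + f) = t^e t^f.\<close>

lemma ideal_prod_supp_on:
  assumes "sg_ideal E" "sg_ideal F"
  shows "supp_on E \<cdot>\<^bsub>A\<^esub> supp_on F = (supp_on (E + F) :: 'k::field fps set)"
proof
  interpret cring "A :: 'k fps ring" by (rule cring_A)
  show "supp_on E \<cdot>\<^bsub>A\<^esub> supp_on F \<subseteq> (supp_on (E + F) :: 'k fps set)"
  proof
    fix x :: "'k fps" assume "x \<in> supp_on E \<cdot>\<^bsub>A\<^esub> supp_on F"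
    then show "x \<in> supp_on (E + F)"
      by induction (auto simp: supp_on_mult supp_on_add)
  qed
  show "(supp_on (E + F) :: 'k fps set) \<subseteq> supp_on E \<cdot>\<^bsub>A\<^esub> supp_on F"
  proof (rule supp_on_subset_ideal)
    show "ideal (supp_on E \<cdot>\<^bsub>A\<^esub> supp_on F) (A :: 'k fps ring)"
      by (intro ideal_prod_is_ideal ideal_supp_on assms)
    show "E + F \<subseteq> H" using sg_ideal_add[OF assms] by (simp add: sg_ideal_def)
    fix n assume "n \<in> E + F"
    then obtain e f where "e \<in> E" "f \<in> F" "n = e + f" by (auto simp: set_plus_iff)
    then show "fps_X ^ n \<in> supp_on E \<cdot>\<^bsub>A\<^esub> (supp_on F :: 'k fps set)"
      using ideal_prod.prod[of "fps_X ^ e" "supp_on E" "fps_X ^ f" "supp_on F" A]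
      by (simp add: power_add)
  qed
qed

lemma ideal_pow_supp_on:
  assumes "sg_ideal E"
  shows "ideal_pow A (supp_on E) n = (supp_on (sg_pow E n) :: 'k::field fps set)"
proof (induction n)
  case 0
  then show ?case by (simp add: nat_pow_def ideals_set_def)
next
  case (Suc n)
  have "ideal_pow A (supp_on E) (Suc n) =
      ideal_pow A (supp_on E) n \<cdot>\<^bsub>A\<^esub> (supp_on E :: 'k fps set)"
    by (simp add: nat_pow_def ideals_set_def)
  also have "\<dots> = supp_on (sg_pow E (Suc n))"
    using ideal_prod_supp_on[OF sg_ideal_pow[OF assms] assms] by (simp add: Suc.IH)
  finally show ?case .
qed

lemma PIdl_X_power:
  assumes "s \<in> H"
  shows "PIdl\<^bsub>A\<^esub> (fps_X ^ s) = (supp_on ({s} + H) :: 'k::field fps set)"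
proof -
  have "x \<in> PIdl\<^bsub>A\<^esub> (fps_X ^ s) \<longleftrightarrow> x \<in> supp_on ({s} + H)" for x :: "'k fps"
  proof
    assume "x \<in> PIdl\<^bsub>A\<^esub> (fps_X ^ s)"
    then obtain y where "y \<in> supp_on H" "x = fps_X ^ s * y"
      by (auto simp: cgenideal_def mult.commute)
    then show "x \<in> supp_on ({s} + H)" by (simp add: X_power_mult_mem_supp_on)
  next
    assume "x \<in> supp_on ({s} + H)"
    then obtain y where "y \<in> supp_on H" "x = fps_X ^ s * y" by (rule supp_on_shift)
    then show "x \<in> PIdl\<^bsub>A\<^esub> (fps_X ^ s)" by (auto simp: cgenideal_def mult.commute)
  qed
  then show ?thesis by blast
qed

lemma sg_ideal_shift: "s \<in> H \<Longrightarrow> sg_ideal ({s} + H)"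
  by (auto simp: sg_ideal_def set_plus_iff add_mem add.assoc)

text \<open>Multiplication by a single monomial t^g shifts the support of x without cancellation, so
  that each exponent of x can be tested separately.\<close>

lemma colon_ideal_supp_on:
  assumes "sg_ideal F"
  shows "colon_ideal A (supp_on ({s} + H)) (supp_on F :: 'k::field fps set) =
    supp_on {n \<in> H. \<forall>g\<in>F. \<exists>h\<in>H. n + g = s + h}" (is "_ = supp_on ?E")
proof -
  have "x \<in> colon_ideal A (supp_on ({s} + H)) (supp_on F) \<longleftrightarrow> x \<in> supp_on ?E" for x :: "'k fps"
  proof
    assume x: "x \<in> colon_ideal A (supp_on ({s} + H)) (supp_on F)"
    show "x \<in> supp_on ?E"
    proof (rule supp_onI)
      fix n assume n: "fps_nth x n \<noteq> 0"
      have "\<exists>h\<in>H. n + g = s + h" if "g \<in> F" for g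
      proof -
        have "fps_X ^ g * x \<in> supp_on ({s} + H)"
          using x that by (simp add: colon_ideal_def)
        moreover have "fps_nth (fps_X ^ g * x) (n + g) \<noteq> 0" using n by (simp add: fps_X_power_mult_nth)
        ultimately show ?thesis by (auto simp: supp_on_def set_plus_iff)
      qed
      moreover have "n \<in> H" using x n by (auto simp: colon_ideal_def supp_on_def)
      ultimately show "n \<in> ?E" by blast
    qed
  next
    assume x: "x \<in> supp_on ?E"
    have "F + ?E \<subseteq> {s} + H" by (auto simp: set_plus_iff) (metis add.commute)
    then have "y * x \<in> supp_on ({s} + H)" if "y \<in> supp_on F" for y
      using supp_on_mult[OF that x] supp_on_mono by blast
    moreover have "x \<in> supp_on H" using x supp_on_mono[of ?E H] by blast
    ultimately show "x \<in> colon_ideal A (supp_on ({s} + H)) (supp_on F)"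
      by (simp add: colon_ideal_def)
  qed
  then show ?thesis by blast
qed

section \<open>The Gorenstein property\<close>

lemma maximal_supp_on: "maximalideal (supp_on (H - {0})) (A :: 'k::field fps ring)"
proof (rule maximalidealI)
  show "ideal (supp_on (H - {0})) (A :: 'k fps ring)" by (intro ideal_supp_on sg_ideal_pos)
  have "1 \<in> carrier (A :: 'k fps ring)" "1 \<notin> (supp_on (H - {0}) :: 'k fps set)"
    using supp_on_H_one by (auto simp: supp_on_def)
  then show "carrier (A :: 'k fps ring) \<noteq> supp_on (H - {0})" by metis
next
  fix J assume J: "ideal J (A :: 'k fps ring)" "supp_on (H - {0}) \<subseteq> J" "J \<subseteq> carrier A"
  interpret ideal J "A :: 'k fps ring" by fact
  show "J = supp_on (H - {0}) \<or> J = carrier A"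
  proof (cases "J \<subseteq> supp_on (H - {0})")
    case False
    then obtain u where u: "u \<in> J" "u \<notin> supp_on (H - {0})" by blast
    have uH: "u \<in> supp_on H" using u J(3) by auto
    have u0: "fps_nth u 0 \<noteq> 0" using u(2) uH unfolding supp_on_def by fastforce
    \<comment> \<open>Subtracting this element of J from u leaves a nonzero constant in J, which
      avoids inverting u in A.\<close>
    have "u - fps_const (fps_nth u 0) \<in> supp_on (H - {0})"
      using uH by (auto simp: supp_on_def)
    then have "u - fps_const (fps_nth u 0) \<in> J" using J(2) by blast
    then have "u \<ominus>\<^bsub>A\<^esub> (u - fps_const (fps_nth u 0)) \<in> J"
      unfolding a_minus_def using u(1) is_additive_subgroup
      by (intro additive_subgroup.a_closed additive_subgroup.a_inv_closed)
    moreover have "u - fps_const (fps_nth u 0) \<in> supp_on H"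
      using uH by (auto simp: supp_on_def zero_mem)
    ultimately have "fps_const (fps_nth u 0) \<in> J" using uH by (simp add: A_minus)
    then have "fps_const (fps_nth u 0) \<otimes>\<^bsub>A\<^esub> fps_const (inverse (fps_nth u 0)) \<in> J"
      by (rule I_r_closed) (use supp_on_const_mult[OF supp_on_H_one] in simp)
    then have "\<one>\<^bsub>A\<^esub> \<in> J" using u0 by simp
    then show ?thesis using one_imp_carrier by blast
  qed (use J in blast)
qed

text \<open>A nonzero prime P' contains some x = u t^r with u a unit of k[[t]]. For y = t z in the
  maximal ideal, y^(r + c) = x t^c (u^(-1) z^(r + c)): r powers of t supply x, and the other c bring
  the cofactor into A. So P' contains the whole maximal ideal.\<close>

lemma height_maximal_supp_on:
  "ideal_height A (supp_on (H - {0}) :: 'k::field fps set) = 1"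
proof (rule ideal_height_eq_1[of "{0}"])
  interpret domain "A :: 'k fps ring" by (rule domain_A)
  show "primeideal {0} (A :: 'k fps ring)" using zeroprimeideal by simp
  show "primeideal (supp_on (H - {0})) (A :: 'k fps ring)"
    by (rule maximalideal_prime[OF maximal_supp_on])
  have "(fps_X :: 'k fps) ^ Suc c \<in> supp_on (H - {0})"
    unfolding X_power_mem_supp_on by (simp add: conductor_mem)
  moreover have "(fps_X :: 'k fps) ^ Suc c \<noteq> 0" by simp
  ultimately show "{0} \<subset> (supp_on (H - {0}) :: 'k fps set)" using supp_on_zero by blast
next
  fix P P' assume P: "primeideal P (A :: 'k fps ring)" "primeideal P' (A :: 'k fps ring)" "P \<subset> P'"
    and P': "P' \<subset> supp_on (H - {0})"
  interpret P: primeideal P "A :: 'k fps ring" by fact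
  interpret P': primeideal P' "A :: 'k fps ring" by fact
  obtain x where "x \<in> P'" "x \<notin> P" using P(3) by blast
  then have x: "x \<in> P'" "x \<noteq> 0"
    using additive_subgroup.zero_closed[OF P.is_additive_subgroup] by auto
  define u where "u = fps_shift (subdegree x) x"
  have xu: "x = u * fps_X ^ subdegree x" unfolding u_def by (rule subdegree_decompose)
  have "fps_nth u 0 \<noteq> 0" using x by (simp add: u_def)
  then have u: "u * inverse u = 1" by (simp add: inverse_mult_eq_1')
  have "y \<in> P'" if y: "y \<in> supp_on (H - {0})" for y
  proof -
    have "fps_nth y i \<noteq> 0 \<Longrightarrow> 1 \<le> i" for i using y by (cases i) (auto simp: supp_on_def)
    then obtain z where z: "y = fps_X ^ 1 * z" using X_power_dvd_if_supp_ge[of y 1] by blast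
    have "y ^ (subdegree x + c) = (u * inverse u) * (fps_X ^ subdegree x * fps_X ^ c * z ^ (subdegree x + c))"
      by (simp add: u z power_mult_distrib power_add)
    also have "\<dots> = x * (fps_X ^ c * (inverse u * z ^ (subdegree x + c)))"
      by (subst (3) xu) (simp add: mult_ac)
    finally have eq: "y ^ (subdegree x + c) = x * (fps_X ^ c * (inverse u * z ^ (subdegree x + c)))" .
    have "x \<otimes>\<^bsub>A\<^esub> (fps_X ^ c * (inverse u * z ^ (subdegree x + c))) \<in> P'"
      by (rule P'.I_r_closed[OF x(1)]) (simp add: supp_on_H_large)
    then have "y [^]\<^bsub>A\<^esub> (subdegree x + c) \<in> P'"
      by (simp only: semigroup_ring_simps A_nat_pow eq)
    moreover have "y \<in> carrier A" using y supp_on_mono[of "H - {0}" H] by auto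
    ultimately show ?thesis by (rule P'.nat_pow_mem_imp_mem[rotated])
  qed
  then show False using P' by blast
qed

text \<open>Two pseudo-Frobenius numbers \<open>n\<^sub>1 \<noteq> n\<^sub>2\<close> would give two strictly larger ideals
  \<open>f k[[H \<union> {n\<^sub>i}]]\<close> with intersection \<open>f k[[H]]\<close>.\<close>

lemma irreducible_imp_pseudo_frobenius_unique:
  assumes irr: "irreducible_ideal A (PIdl\<^bsub>A\<^esub> (f :: 'k::field fps))"
    and f: "f \<in> supp_on (H - {0})" "f \<noteq> 0"
    and n1: "n1 \<notin> H" "\<And>h. h \<in> H \<Longrightarrow> h \<noteq> 0 \<Longrightarrow> n1 + h \<in> H"
    and n2: "n2 \<notin> H" "\<And>h. h \<in> H \<Longrightarrow> h \<noteq> 0 \<Longrightarrow> n2 + h \<in> H"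
  shows "n1 = n2"
proof (rule ccontr)
  assume "n1 \<noteq> n2"
  define J where "J = (\<lambda>n. (*) f ` supp_on (insert n H))"
  have J: "ideal (J n) (A :: 'k fps ring)" if n: "\<And>h. h \<in> H \<Longrightarrow> h \<noteq> 0 \<Longrightarrow> n + h \<in> H" for n
  proof (rule ideal_AI)
    show "J n \<subseteq> supp_on H"
    proof
      fix x assume "x \<in> J n"
      then obtain g where "g \<in> supp_on (insert n H)" "x = f * g" by (auto simp: J_def)
      \<comment> \<open>Since f has no constant term, n only meets positive elements of H.\<close>
      moreover have "H - {0} + insert n H \<subseteq> H"
      proof
        fix m assume "m \<in> H - {0} + insert n H"
        then obtain i h where "i \<in> H" "i \<noteq> 0" "h \<in> insert n H" "m = i + h"
          by (auto simp: set_plus_iff)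
        then show "m \<in> H" using n[of i] add_mem[of i h] by (auto simp: add.commute)
      qed
      ultimately show "x \<in> supp_on H" using supp_on_mult[OF f(1)] supp_on_mono by blast
    qed
    show "0 \<in> J n" unfolding J_def by (rule image_eqI[of _ _ 0]) simp_all
    show "x + y \<in> J n" if xy: "x \<in> J n" "y \<in> J n" for x y
    proof -
      from xy obtain x' y' where "x' \<in> supp_on (insert n H)" "x = f * x'"
        "y' \<in> supp_on (insert n H)" "y = f * y'" by (auto simp: J_def)
      then show ?thesis
        unfolding J_def by (intro image_eqI[of _ _ "x' + y'"]) (simp_all add: algebra_simps supp_on_add)
    qed
    show "x * y \<in> J n" if xy: "x \<in> J n" "y \<in> supp_on H" for x y
    proof -
      from xy obtain x' where x': "x' \<in> supp_on (insert n H)" "x = f * x'" by (auto simp: J_def)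
      have "insert n H + H \<subseteq> insert n H"
      proof
        fix m assume "m \<in> insert n H + H"
        then obtain i h where "i \<in> insert n H" "h \<in> H" "m = i + h" by (auto simp: set_plus_iff)
        then show "m \<in> insert n H" using n[of h] add_mem[of i h] by (cases "h = 0") auto
      qed
      then have "x' * y \<in> supp_on (insert n H)"
        using supp_on_mult[OF x'(1) xy(2)] supp_on_mono by blast
      then show ?thesis
        unfolding J_def by (rule image_eqI[rotated]) (simp add: x' mult.assoc)
    qed
  qed
  have PIdl: "PIdl\<^bsub>A\<^esub> f = (*) f ` supp_on H"
    unfolding cgenideal_def by (auto simp: mult.commute image_iff)
  have "PIdl\<^bsub>A\<^esub> f = J n1 \<inter> J n2"
  proof
    show "PIdl\<^bsub>A\<^esub> f \<subseteq> J n1 \<inter> J n2"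
      unfolding PIdl J_def using supp_on_mono[of H "insert n1 H"] supp_on_mono[of H "insert n2 H"] by blast
    show "J n1 \<inter> J n2 \<subseteq> PIdl\<^bsub>A\<^esub> f"
    proof
      fix x assume "x \<in> J n1 \<inter> J n2"
      then have "x \<in> J n1" "x \<in> J n2" by simp_all
      then obtain g h where g: "g \<in> supp_on (insert n1 H)" "x = f * g"
        and h: "h \<in> supp_on (insert n2 H)" "x = f * h" unfolding J_def by (elim imageE)
      then have "g = h" using f(2) by simp
      then have "g \<in> supp_on (insert n1 H \<inter> insert n2 H)" using g h supp_on_Int by blast
      moreover have "insert n1 H \<inter> insert n2 H = H" using \<open>n1 \<noteq> n2\<close> by blast
      ultimately have "g \<in> supp_on H" by simp
      then show "x \<in> PIdl\<^bsub>A\<^esub> f" unfolding PIdl g(2) by (rule imageI)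
    qed
  qed
  then have "PIdl\<^bsub>A\<^esub> f = J n1 \<or> PIdl\<^bsub>A\<^esub> f = J n2"
    using irr J[OF n1(2)] J[OF n2(2)] unfolding irreducible_ideal_def by blast
  moreover have "PIdl\<^bsub>A\<^esub> f \<noteq> J n" if "n \<notin> H" for n
  proof
    assume "PIdl\<^bsub>A\<^esub> f = J n"
    moreover have "f * fps_X ^ n \<in> J n" unfolding J_def by (rule imageI) simp
    ultimately have "f * fps_X ^ n \<in> (*) f ` supp_on H" by (simp add: PIdl)
    then have "(fps_X :: 'k fps) ^ n \<in> supp_on H" using f(2) by auto
    then show False using that by simp
  qed
  ultimately show False using n1(1) n2(1) by blast
qed

text \<open>Adding to the gap n the largest h in H for which n + h is still a gap gives a gap that
  every positive element of H moves into H. The Frobenius number c - 1 is another such gap, so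
  uniqueness gives n + h = c - 1.\<close>

lemma pseudo_frobenius_unique_imp_symmetric:
  assumes unique: "\<And>n1 n2. n1 \<notin> H \<Longrightarrow> n2 \<notin> H \<Longrightarrow> (\<And>h. h \<in> H \<Longrightarrow> h \<noteq> 0 \<Longrightarrow> n1 + h \<in> H) \<Longrightarrow>
      (\<And>h. h \<in> H \<Longrightarrow> h \<noteq> 0 \<Longrightarrow> n2 + h \<in> H) \<Longrightarrow> n1 = n2"
    and frobenius: "\<And>n. Suc n = c \<Longrightarrow> n \<notin> H" and "n \<notin> H"
  shows "\<exists>h\<in>H. Suc (n + h) = c"
proof -
  define T where "T = {h \<in> H. n + h \<notin> H}"
  have "T \<subseteq> {..c}"
  proof
    fix h assume "h \<in> T"
    then show "h \<in> {..c}" using conductor_mem[of "n + h"] by (force simp: T_def)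
  qed
  then have fin: "finite T" by (rule finite_subset) simp
  have "0 \<in> T" using \<open>n \<notin> H\<close> by (simp add: T_def zero_mem)
  then have h: "Max T \<in> T" "\<And>h. h \<in> T \<Longrightarrow> h \<le> Max T" using fin by (auto intro: Max_in)
  have "0 < c" using \<open>n \<notin> H\<close> conductor_mem[of n] by (cases c) auto
  have "n + Max T = c - 1"
  proof (rule unique)
    show "n + Max T \<notin> H" using h(1) by (simp add: T_def)
    show "c - 1 \<notin> H" using frobenius[of "c - 1"] \<open>0 < c\<close> by simp
    show "n + Max T + h' \<in> H" if "h' \<in> H" "h' \<noteq> 0" for h'
    proof (rule ccontr)
      assume "n + Max T + h' \<notin> H"
      then have "Max T + h' \<in> T" using h(1) that add_mem by (simp add: T_def add.assoc)
      then show False using h(2) that by fastforce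
    qed
    show "c - 1 + h' \<in> H" if "h' \<in> H" "h' \<noteq> 0" for h'
      using that by (intro conductor_mem) simp
  qed
  then show ?thesis using h(1) \<open>0 < c\<close> by (intro bexI[of _ "Max T"]) (auto simp: T_def)
qed

text \<open>Since the maximal ideal has height 1, a system of parameters is a single element f. It
  is nonzero because (f) contains a power of the maximal ideal, and that ideal is not
  nilpotent.\<close>

lemma gorenstein_imp_symmetric:
  assumes gor: "gorenstein_local (A :: 'k::field fps ring)"
    and frobenius: "\<And>n. Suc n = c \<Longrightarrow> n \<notin> H" and "n \<notin> H"
  shows "\<exists>h\<in>H. Suc (n + h) = c"
proof (rule pseudo_frobenius_unique_imp_symmetric[OF _ frobenius \<open>n \<notin> H\<close>])
  interpret cring "A :: 'k fps ring" by (rule cring_A)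
  have "\<exists>!M. maximalideal M (A :: 'k fps ring)"
    using gor by (simp add: gorenstein_local_def local_ring_def)
  then have max: "max_ideal A = (supp_on (H - {0}) :: 'k fps set)"
    unfolding max_ideal_def using maximal_supp_on by (rule the1_equality)
  obtain xs :: "'k fps list" where xs: "set xs \<subseteq> supp_on (H - {0})" "enat (length xs) = 1"
      "irreducible_ideal A (Idl\<^bsub>A\<^esub> (set xs))"
    and pow: "\<exists>n. ideal_pow A (supp_on (H - {0})) n \<subseteq> Idl\<^bsub>A\<^esub> (set xs)"
    using gor unfolding gorenstein_local_def system_of_parameters_def max height_maximal_supp_on by blast
  have "length xs = Suc 0" using xs(2) by (simp add: one_enat_def)
  then obtain f where f: "xs = [f]" by (auto simp: length_Suc_conv)
  have fH: "f \<in> supp_on (H - {0})" using xs(1) f by simp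
  then have "f \<in> supp_on H" using supp_on_mono[of "H - {0}" H] by auto
  then have Idl: "Idl\<^bsub>A\<^esub> (set xs) = PIdl\<^bsub>A\<^esub> f" by (simp add: f cgenideal_eq_genideal)
  have "f \<noteq> 0"
  proof
    assume "f = 0"
    obtain n where "supp_on (sg_pow (H - {0}) n) \<subseteq> PIdl\<^bsub>A\<^esub> f"
      using pow unfolding Idl ideal_pow_supp_on[OF sg_ideal_pos] by blast
    moreover have "PIdl\<^bsub>A\<^esub> f = {0}" unfolding \<open>f = 0\<close> cgenideal_def by (auto intro!: exI[of _ 0])
    \<comment> \<open>c + 1 serves as a positive element of H, also when c = 0.\<close>
    moreover have "fps_X ^ (Suc c * n) \<in> (supp_on (sg_pow (H - {0}) n) :: 'k fps set)"
      unfolding X_power_mem_supp_on by (rule sg_pow_mem) (simp add: conductor_mem)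
    ultimately have "(fps_X :: 'k fps) ^ (Suc c * n) = 0" by blast
    then show False by simp
  qed
  then show "n1 = n2" if "n1 \<notin> H" "n2 \<notin> H" "\<And>h. h \<in> H \<Longrightarrow> h \<noteq> 0 \<Longrightarrow> n1 + h \<in> H"
    "\<And>h. h \<in> H \<Longrightarrow> h \<noteq> 0 \<Longrightarrow> n2 + h \<in> H" for n1 n2
    using irreducible_imp_pseudo_frobenius_unique[of f n1 n2] that fH xs(3) Idl by simp
qed

end

section \<open>The associated graded ring of a monomial ideal\<close>

lemma fps_mult_nth_least:
  fixes f g :: "'k::comm_ring_1 fps"
  assumes "\<And>i. i < a \<Longrightarrow> fps_nth f i = 0" "\<And>i. i < b \<Longrightarrow> fps_nth g i = 0"
  shows "fps_nth (f * g) (a + b) = fps_nth f a * fps_nth g b"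
proof -
  have "fps_nth (f * g) (a + b) = (\<Sum>i\<in>{0..a + b}. if i = a then fps_nth f a * fps_nth g b else 0)"
    unfolding fps_mult_nth
  proof (rule sum.cong[OF refl])
    fix i assume "i \<in> {0..a + b}"
    then show "fps_nth f i * fps_nth g (a + b - i) = (if i = a then fps_nth f a * fps_nth g b else 0)"
      using assms(1)[of i] assms(2)[of "a + b - i"] by (cases i a rule: linorder_cases) auto
  qed
  then show ?thesis by simp
qed

lemma fps_mult_nth_below:
  fixes f g :: "'k::comm_ring_1 fps"
  assumes "\<And>i. i < a \<Longrightarrow> fps_nth f i = 0" "\<And>i. i < b \<Longrightarrow> fps_nth g i = 0" "n < a + b"
  shows "fps_nth (f * g) n = 0"
  unfolding fps_mult_nth
proof (rule sum.neutral, rule ballI)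
  fix i assume "i \<in> {0..n}"
  then have "i < a \<or> n - i < b" using assms(3) by auto
  then show "fps_nth f i * fps_nth g (n - i) = 0" using assms(1)[of i] assms(2)[of "n - i"] by auto
qed

text \<open>What the study of G(I) requires of the exponents: t^s lies in I and has the least order
  there, and the intersection of (t^s) with I^(n+1) is contained in t^s I^n.\<close>

locale shifted_sg_ideal = numerical_semigroup +
  fixes E :: "nat set" and s :: nat
  assumes E_ideal: "sg_ideal E"
    and s_mem_E: "s \<in> E"
    and E_ge: "e \<in> E \<Longrightarrow> s \<le> e"
    and s_pos: "0 < s"
    and shift_mem_E_pow: "h \<in> H \<Longrightarrow> s + h \<in> sg_pow E (Suc n) \<Longrightarrow> h \<in> sg_pow E n"
begin

text \<open>x - s(n + 1) \<ge> c. As I^n starts at order s n, at most s + c orders survive in I^n /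
  I^(n+1); this is the origin of s + c as exponent of nilpotency and as bound in the finite
  generation of ideals.\<close>

lemma large_mem_E_pow:
  assumes "s * n + (s + c) \<le> x"
  shows "x \<in> sg_pow E (Suc n)"
proof -
  have "x - s * Suc n \<in> H" using assms by (intro conductor_mem) simp
  moreover have "s * Suc n \<in> sg_pow E (Suc n)" by (rule sg_pow_mem[OF s_mem_E])
  ultimately have "s * Suc n + (x - s * Suc n) \<in> sg_pow E (Suc n)"
    using sg_ideal_pow[OF E_ideal] unfolding sg_ideal_def by blast
  then show ?thesis using assms by simp
qed

abbreviation Ipow :: "nat \<Rightarrow> 'k::field fps set" where
  "Ipow n \<equiv> supp_on (sg_pow E n)"

lemma Ipow_mult: "f \<in> Ipow m \<Longrightarrow> g \<in> Ipow n \<Longrightarrow> f * g \<in> Ipow (m + n)"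
  using supp_on_mult[of f "sg_pow E m" g "sg_pow E n"] by (simp add: sg_pow_add[OF E_ideal])

text \<open>Makes the product of G(I) independent of representatives, by f' g' - f g = f' (g' - g) +
  (f' - f) g.\<close>

lemma Ipow_mult_diff:
  assumes "f \<in> Ipow i" "f' - f \<in> Ipow (Suc i)" "g \<in> Ipow j" "g' - g \<in> Ipow (Suc j)"
  shows "f' * g' - f * g \<in> Ipow (Suc (i + j))"
proof -
  have "f' - f \<in> Ipow i"
    using assms(2) supp_on_mono[OF sg_pow_Suc_subset[OF E_ideal]] by blast
  then have "f' \<in> Ipow i" using supp_on_add[OF assms(1)] by fastforce
  then have "f' * (g' - g) \<in> Ipow (i + Suc j)" using assms(4) by (rule Ipow_mult)
  moreover have "(f' - f) * g \<in> Ipow (Suc i + j)" using assms(2,3) by (rule Ipow_mult)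
  moreover have "f' * g' - f * g = f' * (g' - g) + (f' - f) * g" by (simp add: algebra_simps)
  ultimately show ?thesis using supp_on_add by fastforce
qed

lemma Ipow_subset: "f \<in> Ipow n \<Longrightarrow> f \<in> supp_on H"
  using supp_on_mono[OF sg_pow_subset[OF E_ideal]] by blast

lemma Ipow_nth_eq_0: "f \<in> Ipow n \<Longrightarrow> i < s * n \<Longrightarrow> fps_nth f i = 0"
  using sg_pow_ge[of E s i n] E_ge by (meson not_le supp_onD)

lemma Ipow_large: "(\<And>i. i < s * n + (s + c) \<Longrightarrow> fps_nth f i = 0) \<Longrightarrow> f \<in> Ipow (Suc n)"
  by (intro supp_onI large_mem_E_pow) (meson not_le)

lemma X_power_s_mem: "fps_const a * fps_X ^ (s * n) \<in> Ipow n"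
  by (intro supp_on_const_mult) (simp add: sg_pow_mem[OF s_mem_E])

text \<open>\<open>shift_mem_E_pow\<close>, applied m times to every exponent; in G(I) this is the
  cancellation of T^m.\<close>

lemma X_power_s_cancel:
  assumes "f \<in> supp_on H" "fps_X ^ (s * m) * f \<in> Ipow (m + n)"
  shows "f \<in> Ipow n"
  using assms(2)
proof (induction m)
  case (Suc m)
  have g: "fps_X ^ (s * m) * f \<in> supp_on H"
    using sg_pow_mem[OF s_mem_E, of m] sg_pow_subset[OF E_ideal, of m] assms(1)
    by (intro supp_on_H_mult) auto
  have "fps_X ^ (s * m) * f \<in> Ipow (m + n)"
  proof (rule supp_onI)
    fix i assume i: "fps_nth (fps_X ^ (s * m) * f) i \<noteq> 0"
    have "fps_X ^ s * (fps_X ^ (s * m) * f) \<in> Ipow (Suc (m + n))"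
      using Suc.prems by (simp add: power_add mult.assoc)
    moreover have "fps_nth (fps_X ^ s * (fps_X ^ (s * m) * f)) (s + i) \<noteq> 0"
      using i by (subst fps_X_power_mult_nth) simp
    ultimately have "s + i \<in> sg_pow E (Suc (m + n))" by (meson supp_onD)
    moreover have "i \<in> H" using supp_onD[OF g] i by blast
    ultimately show "i \<in> sg_pow E (m + n)" by (rule shift_mem_E_pow[rotated])
  qed
  then show ?case by (rule Suc.IH)
qed simp

section \<open>The ring structure of G(I), induced from the Rees algebra\<close>

definition coset :: "nat \<Rightarrow> 'k::field fps \<Rightarrow> 'k fps set" where
  "coset n r = {f. f - r \<in> Ipow (Suc n)}"

lemma a_r_coset_Ipow: "Ipow (Suc n) +>\<^bsub>A\<^esub> r = coset n r"
  unfolding coset_def a_r_coset_def' by (force simp: set_eq_iff)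

lemma coset_eq_iff: "coset n r = coset n r' \<longleftrightarrow> r - r' \<in> Ipow (Suc n)"
proof
  assume eq: "coset n r = coset n r'"
  have "r \<in> coset n r" by (simp add: coset_def)
  then show "r - r' \<in> Ipow (Suc n)" by (simp add: eq) (simp add: coset_def)
next
  assume d: "r - r' \<in> Ipow (Suc n)"
  have "f - r \<in> Ipow (Suc n) \<longleftrightarrow> f - r' \<in> Ipow (Suc n)" for f
    using supp_on_add[OF _ d, of "f - r"] supp_on_diff[OF _ d, of "f - r'"] by auto
  then show "coset n r = coset n r'" by (simp add: coset_def)
qed

lemma coset_zero: "coset n 0 = Ipow (Suc n)"
  by (simp add: coset_def)

definition G :: "(nat \<Rightarrow> 'k::field fps set) ring" where
  "G = assoc_graded A (supp_on E)"

lemma Ipow_eq: "ideal_pow A (supp_on E) n = Ipow n"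
  by (rule ideal_pow_supp_on[OF E_ideal])

lemma Ipow_Suc_eq: "Ipow n \<otimes>\<^bsub>ideals_set A\<^esub> supp_on E = Ipow (Suc n)"
  by (metis Ipow_eq nat_pow_Suc)

lemma Ipow_0_eq: "\<one>\<^bsub>ideals_set A\<^esub> = Ipow 0"
  by (metis Ipow_eq nat_pow_0)

lemmas Ipow_eqs = Ipow_eq Ipow_Suc_eq Ipow_0_eq

lemma carrier_G: "carrier G = {x. (\<forall>n. \<exists>r\<in>Ipow n. x n = coset n r) \<and> finite {n. x n \<noteq> coset n 0}}"
  by (simp add: G_def assoc_graded_def Ipow_eqs a_r_coset_Ipow coset_zero del: sg_pow.simps)

text \<open>The Rees algebra of \<open>I\<close>, as a set of polynomials over \<open>k[[t]]\<close>; its elements represent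
  those of the associated graded ring.\<close>

definition Rees :: "'k::field fps poly set" where
  "Rees = {P. \<forall>n. coeff P n \<in> Ipow n}"

text \<open>On \<open>Rees\<close>, the quotient map of the Rees algebra R(I) onto R(I) / I R(I),
  which is G(I).\<close>

definition proj :: "'k::field fps poly \<Rightarrow> nat \<Rightarrow> 'k fps set" where
  "proj P = (\<lambda>n. coset n (coeff P n))"

lemma ReesD: "P \<in> Rees \<Longrightarrow> coeff P n \<in> Ipow n"
  by (simp add: Rees_def)

lemma proj_eq_iff: "proj P = proj Q \<longleftrightarrow> (\<forall>n. coeff P n - coeff Q n \<in> Ipow (Suc n))"
  by (simp add: proj_def fun_eq_iff coset_eq_iff del: sg_pow.simps)

lemma Rees_add: "P \<in> Rees \<Longrightarrow> Q \<in> Rees \<Longrightarrow> P + Q \<in> Rees"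
  by (simp add: Rees_def supp_on_add)

lemma Rees_diff: "P \<in> Rees \<Longrightarrow> Q \<in> Rees \<Longrightarrow> P - Q \<in> Rees"
  by (simp add: Rees_def supp_on_diff)

lemma Rees_zero: "0 \<in> Rees"
  by (simp add: Rees_def)

lemma Rees_uminus: "P \<in> Rees \<Longrightarrow> - P \<in> Rees"
  using Rees_diff[OF Rees_zero] by simp

lemma Rees_mult:
  assumes "P \<in> Rees" "Q \<in> Rees"
  shows "P * Q \<in> Rees"
proof -
  have "coeff (P * Q) n \<in> Ipow n" for n
    unfolding coeff_mult
  proof (rule supp_on_sum)
    fix i assume "i \<in> {..n}"
    then show "coeff P i * coeff Q (n - i) \<in> Ipow n"
      using Ipow_mult[OF ReesD[OF assms(1), of i] ReesD[OF assms(2), of "n - i"]] by simp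
  qed
  then show ?thesis by (simp add: Rees_def)
qed

lemma Rees_monom: "f \<in> Ipow n \<Longrightarrow> monom f n \<in> Rees"
  by (simp add: Rees_def)

lemma Rees_one: "1 \<in> Rees"
  using Rees_monom[of 1 0] by (simp add: supp_on_H_one monom_0 one_pCons)

lemma Rees_power: "P \<in> Rees \<Longrightarrow> P ^ n \<in> Rees"
  by (induction n) (simp_all add: Rees_one Rees_mult)

lemma proj_mem_carrier:
  assumes "P \<in> Rees" shows "proj P \<in> carrier G"
proof -
  have "{n. proj P n \<noteq> coset n 0} \<subseteq> {..degree P}"
    by (auto simp: proj_def intro: le_degree)
  then show ?thesis
    using assms finite_subset by (fastforce simp: carrier_G proj_def Rees_def)
qed

lemma carrier_obtain:
  assumes "x \<in> carrier G"
  obtains P where "P \<in> Rees" "x = proj P"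
proof -
  \<comment> \<open>Zero cosets get the representative 0, so that the representatives form a
    polynomial.\<close>
  have "\<forall>n. \<exists>r. r \<in> Ipow n \<and> x n = coset n r \<and> (x n = coset n 0 \<longrightarrow> r = 0)"
  proof
    fix n
    show "\<exists>r. r \<in> Ipow n \<and> x n = coset n r \<and> (x n = coset n 0 \<longrightarrow> r = 0)"
    proof (cases "x n = coset n 0")
      case True
      then show ?thesis by (intro exI[of _ 0]) simp
    next
      case False
      moreover obtain r where "r \<in> Ipow n" "x n = coset n r" using assms by (auto simp: carrier_G)
      ultimately show ?thesis by blast
    qed
  qed
  then obtain r where r: "\<And>n. r n \<in> Ipow n" "\<And>n. x n = coset n (r n)"
      "\<And>n. x n = coset n 0 \<Longrightarrow> r n = 0" by metis
  have "finite {n. x n \<noteq> coset n 0}" using assms by (simp add: carrier_G)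
  then obtain N where N: "\<And>n. x n \<noteq> coset n 0 \<Longrightarrow> n \<le> N"
    unfolding finite_nat_set_iff_bounded_le by blast
  have coeff: "coeff (Abs_poly r) n = r n" for n
    by (subst coeff_Abs_poly[of N]) (use N r(3) not_le in blast)+
  show thesis
  proof (rule that)
    show "Abs_poly r \<in> Rees" by (simp add: Rees_def coeff r(1))
    show "x = proj (Abs_poly r)" by (simp add: proj_def coeff r(2) fun_eq_iff)
  qed
qed

lemma proj_add: "proj P \<oplus>\<^bsub>G\<^esub> proj Q = proj (P + Q)"
proof
  fix n
  have "f \<in> proj P n <+>\<^bsub>A\<^esub> proj Q n \<longleftrightarrow> f \<in> proj (P + Q) n" for f
  proof
    assume "f \<in> proj P n <+>\<^bsub>A\<^esub> proj Q n"
    then obtain g h where gh: "g - coeff P n \<in> Ipow (Suc n)" "h - coeff Q n \<in> Ipow (Suc n)" "f = g + h"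
      by (auto simp: set_add_def' proj_def coset_def)
    have "f - coeff (P + Q) n = (g - coeff P n) + (h - coeff Q n)" by (simp add: gh)
    then show "f \<in> proj (P + Q) n"
      using supp_on_add[OF gh(1,2)] unfolding proj_def coset_def mem_Collect_eq by (simp only:)
  next
    assume "f \<in> proj (P + Q) n"
    then have "f - coeff Q n \<in> proj P n" "coeff Q n \<in> proj Q n"
      by (simp_all add: proj_def coset_def diff_diff_eq add.commute)
    moreover have "f = (f - coeff Q n) + coeff Q n" by simp
    ultimately show "f \<in> proj P n <+>\<^bsub>A\<^esub> proj Q n"
      unfolding set_add_def' semigroup_ring_simps by blast
  qed
  then show "(proj P \<oplus>\<^bsub>G\<^esub> proj Q) n = proj (P + Q) n"
    by (auto simp: G_def assoc_graded_def)
qed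

lemma finsum_A:
  assumes "finite S" "\<And>i. i \<in> S \<Longrightarrow> f i \<in> supp_on H"
  shows "(\<Oplus>\<^bsub>A\<^esub>i\<in>S. f i) = (\<Sum>i\<in>S. f i :: 'k::field fps)"
proof -
  interpret cring "A :: 'k fps ring" by (rule cring_A)
  show ?thesis using assms
  proof (induction S rule: finite_induct)
    case empty
    then show ?case by simp
  next
    case (insert i S)
    have "(\<Oplus>\<^bsub>A\<^esub>i\<in>insert i S. f i) = f i \<oplus>\<^bsub>A\<^esub> (\<Oplus>\<^bsub>A\<^esub>i\<in>S. f i)"
      using insert by (intro finsum_insert) auto
    then show ?case using insert by simp
  qed
qed

text \<open>The product in G(I) is a set of sums over all representatives. By
  \<open>Ipow_mult_diff\<close> these differ only by elements of I^(n+1), and the free summand w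
  fills up the coset.\<close>

lemma proj_mult:
  assumes P: "P \<in> Rees" and Q: "Q \<in> Rees"
  shows "proj P \<otimes>\<^bsub>G\<^esub> proj Q = proj (P * Q)"
proof
  fix n
  \<comment> \<open>Passing from the sum in A to a sum of power series requires all representatives
    to lie in A.\<close>
  have coset_subset: "u \<in> supp_on H" if "R \<in> Rees" "u \<in> proj R i" for R u i
  proof -
    have "u = (u - coeff R i) + coeff R i" by simp
    moreover have "u - coeff R i \<in> Ipow (Suc i)" using that(2) unfolding proj_def coset_def by blast
    ultimately show ?thesis
      using Ipow_subset ReesD[OF that(1), of i] supp_on_add by metis
  qed
  have sum_eq: "(\<Oplus>\<^bsub>A\<^esub>i\<in>{..n}. u i * v (n - i)) = (\<Sum>i\<le>n. u i * v (n - i))"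
    if "\<forall>i\<le>n. u i \<in> proj P i \<and> v i \<in> proj Q i" for u v :: "nat \<Rightarrow> 'a fps"
  proof (rule finsum_A)
    fix i assume "i \<in> {..n}"
    then have "u i \<in> proj P i" "v (n - i) \<in> proj Q (n - i)" using that by simp_all
    then show "u i * v (n - i) \<in> supp_on H"
      using coset_subset[OF P] coset_subset[OF Q] by (blast intro: supp_on_H_mult)
  qed simp
  have "(proj P \<otimes>\<^bsub>G\<^esub> proj Q) n = {(\<Sum>i\<le>n. u i * v (n - i)) + w |u v w.
      (\<forall>i\<le>n. u i \<in> proj P i \<and> v i \<in> proj Q i) \<and> w \<in> Ipow (Suc n)}"
  proof -
    have "(proj P \<otimes>\<^bsub>G\<^esub> proj Q) n = {(\<Oplus>\<^bsub>A\<^esub>i\<in>{..n}. u i * v (n - i)) + w |u v w.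
        (\<forall>i\<le>n. u i \<in> proj P i \<and> v i \<in> proj Q i) \<and> w \<in> Ipow (Suc n)}"
      unfolding G_def assoc_graded_def by (simp add: Ipow_eqs del: sg_pow.simps)
    also have "\<dots> = {(\<Sum>i\<le>n. u i * v (n - i)) + w |u v w.
        (\<forall>i\<le>n. u i \<in> proj P i \<and> v i \<in> proj Q i) \<and> w \<in> Ipow (Suc n)}"
    proof (intro Collect_cong ex_cong1)
      fix f u v w
      show "(f = (\<Oplus>\<^bsub>A\<^esub>i\<in>{..n}. u i * v (n - i)) + w \<and>
          (\<forall>i\<le>n. u i \<in> proj P i \<and> v i \<in> proj Q i) \<and> w \<in> Ipow (Suc n)) \<longleftrightarrow>
        (f = (\<Sum>i\<le>n. u i * v (n - i)) + w \<and>
          (\<forall>i\<le>n. u i \<in> proj P i \<and> v i \<in> proj Q i) \<and> w \<in> Ipow (Suc n))"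
        by (cases "\<forall>i\<le>n. u i \<in> proj P i \<and> v i \<in> proj Q i") (simp_all only: sum_eq simp_thms)
    qed
    finally show ?thesis .
  qed
  also have "\<dots> = proj (P * Q) n"
  proof (intro equalityI subsetI)
    fix f assume "f \<in> {(\<Sum>i\<le>n. u i * v (n - i)) + w |u v w.
      (\<forall>i\<le>n. u i \<in> proj P i \<and> v i \<in> proj Q i) \<and> w \<in> Ipow (Suc n)}"
    then obtain u v w where f: "f = (\<Sum>i\<le>n. u i * v (n - i)) + w" "w \<in> Ipow (Suc n)"
      and uv: "\<And>i. i \<le> n \<Longrightarrow> u i - coeff P i \<in> Ipow (Suc i)" "\<And>i. i \<le> n \<Longrightarrow> v i - coeff Q i \<in> Ipow (Suc i)"
      by (auto simp: proj_def coset_def)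
    have "u i * v (n - i) - coeff P i * coeff Q (n - i) \<in> Ipow (Suc n)" if "i \<le> n" for i
      using Ipow_mult_diff[OF ReesD[OF P] uv(1)[OF that] ReesD[OF Q] uv(2)[of "n - i"]] that by simp
    then have "(\<Sum>i\<le>n. u i * v (n - i) - coeff P i * coeff Q (n - i)) + w \<in> Ipow (Suc n)"
      by (intro supp_on_add[OF supp_on_sum f(2)]) simp
    then show "f \<in> proj (P * Q) n"
      by (simp add: proj_def coset_def f(1) coeff_mult sum_subtractf algebra_simps del: sg_pow.simps)
  next
    fix f assume "f \<in> proj (P * Q) n"
    then have "f - coeff (P * Q) n \<in> Ipow (Suc n)" unfolding proj_def coset_def by blast
    moreover have "f = (\<Sum>i\<le>n. coeff P i * coeff Q (n - i)) + (f - coeff (P * Q) n)"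
      by (simp add: coeff_mult)
    moreover have "\<forall>i\<le>n. coeff P i \<in> proj P i \<and> coeff Q i \<in> proj Q i"
      by (simp add: proj_def coset_def)
    ultimately show "f \<in> {(\<Sum>i\<le>n. u i * v (n - i)) + w |u v w.
      (\<forall>i\<le>n. u i \<in> proj P i \<and> v i \<in> proj Q i) \<and> w \<in> Ipow (Suc n)}" by blast
  qed
  finally show "(proj P \<otimes>\<^bsub>G\<^esub> proj Q) n = proj (P * Q) n" .
qed

lemma G_zero: "\<zero>\<^bsub>G\<^esub> = proj 0"
  by (simp add: G_def assoc_graded_def proj_def coset_zero Ipow_eqs del: sg_pow.simps)

lemma G_one: "\<one>\<^bsub>G\<^esub> = (proj 1 :: nat \<Rightarrow> 'k::field fps set)"
proof
  fix n
  have "\<one>\<^bsub>G\<^esub> n = (if n = 0 then Ipow (Suc 0) +>\<^bsub>A\<^esub> 1 else coset n 0 :: 'k fps set)"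
    by (simp add: G_def assoc_graded_def coset_zero Ipow_eqs del: sg_pow.simps)
  then show "\<one>\<^bsub>G\<^esub> n = (proj 1 :: nat \<Rightarrow> 'k fps set) n"
    by (cases n) (simp_all add: proj_def a_r_coset_Ipow del: sg_pow.simps)
qed

text \<open>\<open>proj\<close> maps \<open>Rees\<close> onto G(I) and respects the operations, so
  the ring laws are inherited from polynomials over k[[t]].\<close>

lemma cring_G: "cring (G :: (nat \<Rightarrow> 'k::field fps set) ring)"
proof (rule cringI)
  show "abelian_group (G :: (nat \<Rightarrow> 'k fps set) ring)"
  proof (rule abelian_groupI)
    fix x assume "x \<in> carrier (G :: (nat \<Rightarrow> 'k fps set) ring)"
    then obtain P where P: "P \<in> Rees" "x = proj P" by (rule carrier_obtain)
    show "\<exists>y\<in>carrier G. y \<oplus>\<^bsub>G\<^esub> x = \<zero>\<^bsub>G\<^esub>"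
      using proj_mem_carrier[OF Rees_uminus[OF P(1)]]
      by (intro bexI[of _ "proj (- P)"]) (simp_all add: P proj_add G_zero)
  next
    fix x y z :: "nat \<Rightarrow> 'k fps set"
    assume xyz: "x \<in> carrier G" "y \<in> carrier G" "z \<in> carrier G"
    show "x \<oplus>\<^bsub>G\<^esub> y \<in> carrier G" "x \<oplus>\<^bsub>G\<^esub> y = y \<oplus>\<^bsub>G\<^esub> x" "\<zero>\<^bsub>G\<^esub> \<oplus>\<^bsub>G\<^esub> x = x"
      "x \<oplus>\<^bsub>G\<^esub> y \<oplus>\<^bsub>G\<^esub> z = x \<oplus>\<^bsub>G\<^esub> (y \<oplus>\<^bsub>G\<^esub> z)"
      using xyz by (elim carrier_obtain; simp add: proj_add G_zero proj_mem_carrier Rees_add add_ac)+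
  qed (simp add: G_zero proj_mem_carrier Rees_zero)
  show "comm_monoid (G :: (nat \<Rightarrow> 'k fps set) ring)"
  proof (rule comm_monoidI)
    fix x y z :: "nat \<Rightarrow> 'k fps set"
    assume xyz: "x \<in> carrier G" "y \<in> carrier G" "z \<in> carrier G"
    show "x \<otimes>\<^bsub>G\<^esub> y \<in> carrier G" "x \<otimes>\<^bsub>G\<^esub> y = y \<otimes>\<^bsub>G\<^esub> x" "\<one>\<^bsub>G\<^esub> \<otimes>\<^bsub>G\<^esub> x = x"
      "x \<otimes>\<^bsub>G\<^esub> y \<otimes>\<^bsub>G\<^esub> z = x \<otimes>\<^bsub>G\<^esub> (y \<otimes>\<^bsub>G\<^esub> z)"
      using xyz by (elim carrier_obtain; simp add: proj_mult G_one proj_mem_carrier Rees_mult Rees_one mult_ac)+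
  qed (simp add: G_one proj_mem_carrier Rees_one)
next
  fix x y z :: "nat \<Rightarrow> 'k fps set"
  assume xyz: "x \<in> carrier G" "y \<in> carrier G" "z \<in> carrier G"
  show "(x \<oplus>\<^bsub>G\<^esub> y) \<otimes>\<^bsub>G\<^esub> z = x \<otimes>\<^bsub>G\<^esub> z \<oplus>\<^bsub>G\<^esub> y \<otimes>\<^bsub>G\<^esub> z"
    using xyz by (elim carrier_obtain) (simp add: proj_mult proj_add Rees_mult Rees_add distrib_right)
qed

lemma proj_power: "P \<in> Rees \<Longrightarrow> proj P [^]\<^bsub>G\<^esub> (n::nat) = proj (P ^ n)"
  by (induction n) (simp_all add: nat_pow_def G_one proj_mult Rees_power mult.commute)

section \<open>Leading coefficients: the map from G(I) to k[T] and its nilpotent kernel\<close>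

definition lead :: "'k::field fps poly \<Rightarrow> 'k poly" where
  "lead P = Abs_poly (\<lambda>n. fps_nth (coeff P n) (s * n))"

lemma coeff_lead: "coeff (lead P) n = fps_nth (coeff P n) (s * n)"
  unfolding lead_def by (subst coeff_Abs_poly[of "degree P"]) (simp_all add: coeff_eq_0)

lemma lead_add: "lead (P + Q) = lead P + lead Q"
  by (simp add: poly_eq_iff coeff_lead)

text \<open>s i and s (n - i) are the least possible orders in I^i and I^(n-i), so only the product
  of the two lowest terms contributes at s n.\<close>

lemma lead_mult:
  assumes "P \<in> Rees" "Q \<in> Rees"
  shows "lead (P * Q) = lead P * lead Q"
proof (rule poly_eqI)
  fix n
  have "fps_nth (coeff P i * coeff Q (n - i)) (s * n) = fps_nth (coeff P i) (s * i) * fps_nth (coeff Q (n - i)) (s * (n - i))"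
    if "i \<le> n" for i
  proof -
    have "s * n = s * i + s * (n - i)" using that by (metis add_mult_distrib2 le_add_diff_inverse)
    then show ?thesis
      using fps_mult_nth_least[OF Ipow_nth_eq_0[OF ReesD[OF assms(1)]] Ipow_nth_eq_0[OF ReesD[OF assms(2)]]]
      by metis
  qed
  then show "coeff (lead (P * Q)) n = coeff (lead P * lead Q) n"
    by (simp add: coeff_lead coeff_mult fps_sum_nth)
qed

lemma lead_one: "lead 1 = 1"
  by (rule poly_eqI) (simp add: coeff_lead)

lemma lead_cong:
  assumes "proj P = proj Q"
  shows "lead P = lead Q"
proof (rule poly_eqI)
  fix n
  have "coeff P n - coeff Q n \<in> Ipow (Suc n)" using assms unfolding proj_eq_iff by blast
  \<comment> \<open>I^(n+1) starts at order s(n + 1), which exceeds s n because s > 0.\<close>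
  then have "fps_nth (coeff P n - coeff Q n) (s * n) = 0"
    by (rule Ipow_nth_eq_0) (use s_pos in simp)
  then show "coeff (lead P) n = coeff (lead Q) n" by (simp add: coeff_lead)
qed

text \<open>Any representative will do, in \<open>Rees\<close> or not, since the leading
  coefficients depend only on the cosets.\<close>

definition \<phi> :: "(nat \<Rightarrow> 'k::field fps set) \<Rightarrow> 'k poly" where
  "\<phi> x = lead (SOME P. proj P = x)"

lemma \<phi>_proj: "\<phi> (proj P) = lead P"
  unfolding \<phi>_def by (rule lead_cong) (rule someI_ex, blast)

text \<open>In the Rees algebra the orders in degree n are at least s n; the excess measures how far
  they lie above this line, and it adds up under multiplication.\<close>

definition excess :: "nat \<Rightarrow> 'k::field fps poly \<Rightarrow> bool" where
  "excess m P \<longleftrightarrow> (\<forall>n. \<forall>j<s * n + m. fps_nth (coeff P n) j = 0)"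

lemma excess_mult:
  assumes "excess m P" "excess m' Q"
  shows "excess (m + m') (P * Q)"
  unfolding excess_def coeff_mult fps_sum_nth
proof (intro allI impI sum.neutral ballI)
  fix n j i assume j: "j < s * n + (m + m')" and i: "i \<in> {..n}"
  have "s * n = s * i + s * (n - i)" using i by (metis add_mult_distrib2 atMost_iff le_add_diff_inverse)
  then have "j < (s * i + m) + (s * (n - i) + m')" using j by simp
  then show "fps_nth (coeff P i * coeff Q (n - i)) j = 0"
    by (rule fps_mult_nth_below[rotated 2]) (use assms in \<open>simp_all add: excess_def\<close>)
qed

lemma excess_power: "P \<in> Rees \<Longrightarrow> excess 1 P \<Longrightarrow> excess n (P ^ n)"
proof (induction n)
  case 0
  then show ?case using Ipow_nth_eq_0[OF ReesD[OF Rees_one]] by (simp add: excess_def)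
next
  case (Suc n)
  then show ?case using excess_mult[of 1 P n "P ^ n"] by simp
qed

text \<open>Vanishing of the leading coefficients means excess 1, so the power s + c has excess s +
  c, which puts its coefficient of degree n into I^(n+1).\<close>

lemma proj_nilpotent:
  assumes P: "P \<in> Rees" and "lead P = 0"
  shows "proj (P ^ (s + c)) = proj 0"
proof -
  have "excess 1 P"
    unfolding excess_def
  proof (intro allI impI)
    fix n j assume "j < s * n + 1"
    then consider "j < s * n" | "j = s * n" by linarith
    then show "fps_nth (coeff P n) j = 0"
    proof cases
      case 1
      then show ?thesis by (rule Ipow_nth_eq_0[OF ReesD[OF P]])
    next
      case 2
      then show ?thesis using coeff_lead[of P n] assms(2) by simp
    qed
  qed
  then have "excess (s + c) (P ^ (s + c))" by (rule excess_power[OF P])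
  then show ?thesis
    unfolding proj_eq_iff excess_def by (auto intro!: Ipow_large simp del: sg_pow.simps)
qed

text \<open>Sends T to t^s in degree 1; a section of \<open>lead\<close>, which supplies the copy of
  k[T] inside G(I).\<close>

definition embed :: "'k::field poly \<Rightarrow> 'k fps poly" where
  "embed p = Abs_poly (\<lambda>n. fps_const (coeff p n) * fps_X ^ (s * n))"

lemma coeff_embed: "coeff (embed p) n = fps_const (coeff p n) * fps_X ^ (s * n)"
  unfolding embed_def by (subst coeff_Abs_poly[of "degree p"]) (simp_all add: coeff_eq_0)

lemma embed_mem_Rees: "embed p \<in> Rees"
  by (simp add: Rees_def coeff_embed X_power_s_mem)

lemma lead_embed: "lead (embed p) = p"
  by (rule poly_eqI) (simp add: coeff_lead coeff_embed fps_X_power_nth)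

text \<open>Compare coefficients at \<open>n + deg p\<close>, where \<open>n\<close> is the largest degree in which \<open>Q\<close> is
  nonzero in the associated graded ring.\<close>

lemma embed_nonzerodivisor:
  assumes Q: "Q \<in> Rees" and "p \<noteq> 0" and eq: "proj (Q * embed p) = proj 0"
  shows "proj Q = proj 0"
proof (rule ccontr)
  assume "proj Q \<noteq> proj 0"
  then have ex: "\<exists>n. coeff Q n \<notin> Ipow (Suc n)" by (simp add: proj_eq_iff del: sg_pow.simps)
  have bd: "coeff Q n \<notin> Ipow (Suc n) \<Longrightarrow> n \<le> degree Q" for n
    by (rule le_degree) auto
  obtain n where n: "coeff Q n \<notin> Ipow (Suc n)"
    and max: "\<And>m. coeff Q m \<notin> Ipow (Suc m) \<Longrightarrow> m \<le> n"
    using Greatest_le_nat[of "\<lambda>n. coeff Q n \<notin> Ipow (Suc n)"] GreatestI_ex_nat[OF ex] bd by blast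
  define d where "d = degree p"
  have "coeff (Q * embed p) (n + d) \<in> Ipow (Suc (n + d))"
    using eq unfolding proj_eq_iff by (simp del: sg_pow.simps)
  moreover have "coeff (Q * embed p) (n + d) =
      coeff Q n * coeff (embed p) d + (\<Sum>i\<in>{..n + d} - {n}. coeff Q i * coeff (embed p) (n + d - i))"
    unfolding coeff_mult by (subst sum.remove[of _ n]) simp_all
  \<comment> \<open>For i < n the second factor has degree above deg p, and for i > n the maximality
    of n applies.\<close>
  moreover have "(\<Sum>i\<in>{..n + d} - {n}. coeff Q i * coeff (embed p) (n + d - i)) \<in> Ipow (Suc (n + d))"
  proof (rule supp_on_sum)
    fix i assume i: "i \<in> {..n + d} - {n}"
    show "coeff Q i * coeff (embed p) (n + d - i) \<in> Ipow (Suc (n + d))"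
    proof (cases "i < n")
      case True
      then have "coeff (embed p) (n + d - i) = 0" by (simp add: coeff_embed d_def coeff_eq_0)
      then show ?thesis by simp
    next
      case False
      then have "coeff Q i \<in> Ipow (Suc i)" using max[of i] i by fastforce
      then show ?thesis
        using Ipow_mult[OF _ ReesD[OF embed_mem_Rees[of p]], of "coeff Q i" "Suc i" "n + d - i"] i by simp
    qed
  qed
  ultimately have "coeff Q n * coeff (embed p) d \<in> Ipow (Suc (n + d))"
    using supp_on_diff by fastforce
  \<comment> \<open>Dividing by the leading coefficient of p leaves t^(s d) times the coefficient of
    Q.\<close>
  then have "fps_const (inverse (coeff p d)) * (coeff Q n * coeff (embed p) d) \<in> Ipow (Suc (n + d))"
    by (rule supp_on_const_mult)
  moreover have "fps_const (inverse (coeff p d)) * (coeff Q n * coeff (embed p) d) =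
      fps_const (inverse (coeff p d) * coeff p d) * (fps_X ^ (s * d) * coeff Q n)"
    by (simp add: coeff_embed mult_ac flip: fps_const_mult)
  moreover have "inverse (coeff p d) * coeff p d = 1" using \<open>p \<noteq> 0\<close> by (simp add: d_def)
  ultimately have "fps_X ^ (s * d) * coeff Q n \<in> Ipow (d + Suc n)" by (simp add: add.commute)
  then have "coeff Q n \<in> Ipow (Suc n)" by (rule X_power_s_cancel[OF Ipow_subset[OF ReesD[OF Q]]])
  then show False using n by blast
qed

lemma nilpotent_over_poly_G:
  "nilpotent_over_poly G (\<phi> :: (nat \<Rightarrow> 'k::field fps set) \<Rightarrow> 'k poly) (s + c)"
proof (rule nilpotent_over_poly.intro[OF cring_G], rule nilpotent_over_poly_axioms.intro)
  show "\<phi> (x \<oplus>\<^bsub>G\<^esub> y) = \<phi> x + \<phi> y" if "x \<in> carrier G" "y \<in> carrier G" for x y :: "nat \<Rightarrow> 'k fps set"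
    using that by (auto elim!: carrier_obtain simp: proj_add \<phi>_proj lead_add)
  show "\<phi> (x \<otimes>\<^bsub>G\<^esub> y) = \<phi> x * \<phi> y" if "x \<in> carrier G" "y \<in> carrier G" for x y :: "nat \<Rightarrow> 'k fps set"
    using that by (auto elim!: carrier_obtain simp: proj_mult \<phi>_proj lead_mult)
  show "\<phi> \<one>\<^bsub>G\<^esub> = (1 :: 'k poly)" by (simp add: G_one \<phi>_proj lead_one)
  show "\<exists>x\<in>carrier G. \<phi> x = p \<and> (\<forall>y\<in>carrier G. y \<otimes>\<^bsub>G\<^esub> x = \<zero>\<^bsub>G\<^esub> \<longrightarrow> y = \<zero>\<^bsub>G\<^esub>)"
    if "p \<noteq> 0" for p :: "'k poly"
  proof (intro bexI[of _ "proj (embed p)"] conjI ballI impI)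
    show "\<phi> (proj (embed p)) = p" by (simp add: \<phi>_proj lead_embed)
    show "proj (embed p) \<in> carrier G" by (rule proj_mem_carrier[OF embed_mem_Rees])
    fix y assume "y \<in> carrier G" and y0: "y \<otimes>\<^bsub>G\<^esub> proj (embed p) = \<zero>\<^bsub>G\<^esub>"
    then obtain Q where Q: "Q \<in> Rees" "y = proj Q" by (elim carrier_obtain)
    then show "y = \<zero>\<^bsub>G\<^esub>"
      using y0 embed_nonzerodivisor[OF Q(1) that] by (simp add: proj_mult embed_mem_Rees G_zero)
  qed
  show "x [^]\<^bsub>G\<^esub> (s + c) = \<zero>\<^bsub>G\<^esub>" if x: "x \<in> carrier G" "\<phi> x = 0" for x :: "nat \<Rightarrow> 'k fps set"
  proof -
    obtain P where "P \<in> Rees" "x = proj P" using x(1) by (rule carrier_obtain)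
    then show ?thesis using x(2) proj_nilpotent[of P] by (simp add: \<phi>_proj proj_power G_zero)
  qed
qed

end

section \<open>Finite generation of the ideals of G(I), and the Cohen-Macaulay property\<close>

context shifted_sg_ideal
begin

text \<open>Divided by \<open>t^(s n)\<close>, the nonzero elements of degree \<open>n\<close> of the associated graded ring have
  representatives of order below \<open>s + c\<close>. For each order \<open>r\<close> an ideal element of least degree
  with this leading order is put into the generating set; its multiples by powers of \<open>t^s\<close>
  then remove the leading terms of all other elements.\<close>

lemma ideal_G_finitely_generated:
  assumes "ideal J (G :: (nat \<Rightarrow> 'k::field fps set) ring)"
  shows "\<exists>S\<subseteq>carrier G. finite S \<and> J = Idl\<^bsub>G\<^esub> S"
proof -
  interpret G: cring "G :: (nat \<Rightarrow> 'k fps set) ring" by (rule cring_G)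
  interpret J: ideal J "G :: (nat \<Rightarrow> 'k fps set) ring" by fact
  define N where "N = s + c"
  define LT :: "nat \<Rightarrow> nat \<Rightarrow> 'k fps poly \<Rightarrow> bool" where
    "LT r n P \<longleftrightarrow> P \<in> Rees \<and> proj P \<in> J \<and> (\<forall>m>n. coeff P m = 0) \<and>
      (\<forall>j<s * n + r. fps_nth (coeff P n) j = 0) \<and> fps_nth (coeff P n) (s * n + r) \<noteq> 0" for r n P
  define R where "R = {r. r < N \<and> (\<exists>n P. LT r n P)}"
  define d where "d r = (LEAST n. \<exists>P. LT r n P)" for r
  define B where "B r = (SOME P. LT r (d r) P)" for r
  have B: "LT r (d r) (B r)" if "r \<in> R" for r
  proof -
    have "\<exists>n P. LT r n P" using that by (simp add: R_def)
    then have "\<exists>P. LT r (d r) P" unfolding d_def by (rule LeastI_ex)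
    then show ?thesis unfolding B_def by (rule someI_ex)
  qed
  have d_le: "d r \<le> n" if "LT r n P" for r n P
    unfolding d_def using that by (intro Least_le exI)
  define S where "S = (\<lambda>r. proj (B r)) ` R"
  have "S \<subseteq> J" using B by (auto simp: S_def LT_def)
  then have S_carrier: "S \<subseteq> carrier G" using J.a_subset by (rule order_trans)
  have "finite S" by (simp add: S_def R_def)
  interpret I: ideal "Idl\<^bsub>G\<^esub> S" G by (rule G.genideal_ideal[OF S_carrier])
  \<comment> \<open>Serves both J, so that reduction stays in the ideal, and the ideal generated by
    S, so that membership returns from the reduced element.\<close>
  have combine: "proj (P + M * Q) \<in> K"
    if "ideal K G" "P \<in> Rees" "Q \<in> Rees" "M \<in> Rees" "proj P \<in> K" "proj Q \<in> K" for K P Q M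
  proof -
    interpret K: ideal K G by fact
    have "proj P \<oplus>\<^bsub>G\<^esub> proj M \<otimes>\<^bsub>G\<^esub> proj Q \<in> K"
      by (intro additive_subgroup.a_closed[OF K.is_additive_subgroup] K.I_l_closed that(5,6)
          proj_mem_carrier that(4))
    then show ?thesis using that by (simp add: proj_mult proj_add)
  qed
  have gen: "proj P \<in> Idl\<^bsub>G\<^esub> S"
    if "P \<in> Rees" "proj P \<in> J" "\<forall>m>n. coeff P m = 0" "\<forall>j<s * n + r. fps_nth (coeff P n) j = 0" for P n r
    using that
  \<comment> \<open>A lexicographic descent: the degree bound n falls or, with n fixed, the order r
    rises. Since N - r \<le> N < N + 1, lowering n outweighs resetting r to 0.\<close>
  proof (induction "n * (N + 1) + (N - r)" arbitrary: P n r rule: less_induct)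
    case less
    show ?case
    proof (cases "r < N")
      case False
      define P' where "P' = P - monom (coeff P n) n"
      \<comment> \<open>Order at least s n + s + c: the coefficient of degree n vanishes in G(I) and
        may be dropped.\<close>
      have "coeff P n \<in> Ipow (Suc n)" using less.prems(4) False by (intro Ipow_large) (simp add: N_def)
      then have eq: "proj P' = proj P"
        by (auto simp: proj_eq_iff P'_def supp_on_uminus simp del: sg_pow.simps)
      have P': "P' \<in> Rees" unfolding P'_def
        using less.prems(1) by (intro Rees_diff Rees_monom ReesD)
      have zero: "\<forall>m\<ge>n. coeff P' m = 0" using less.prems(3) by (auto simp: P'_def)
      show ?thesis
      proof (cases n)
        case 0
        then have "P' = 0" using zero by (simp add: poly_eq_iff)
        then show ?thesis
          using additive_subgroup.zero_closed[OF I.is_additive_subgroup] eq by (simp add: G_zero)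
      next
        case (Suc n')
        have "proj P' \<in> Idl\<^bsub>G\<^esub> S"
        proof (rule less.hyps[of n' 0])
          show "\<forall>j<s * n' + 0. fps_nth (coeff P' n') j = 0"
            using Ipow_nth_eq_0[OF ReesD[OF P']] by simp
        qed (use P' eq less.prems(2) zero Suc in auto)
        then show ?thesis by (simp add: eq)
      qed
    next
      case r: True
      show ?thesis
      proof (cases "fps_nth (coeff P n) (s * n + r) = 0")
        case True
        then have "\<forall>j<s * n + Suc r. fps_nth (coeff P n) j = 0" using less.prems(4) by (auto simp: less_Suc_eq)
        then show ?thesis using less.prems r by (intro less.hyps[of n "Suc r"]) auto
      next
        case False
        then have LT: "LT r n P" using less.prems by (simp add: LT_def)
        then have "r \<in> R" using r by (auto simp: R_def)
        note BLT = B[OF this, unfolded LT_def]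
        define k where "k = n - d r"
        have n: "n = k + d r" using d_le[OF LT] by (simp add: k_def)
        define \<mu> where "\<mu> = fps_nth (coeff P n) (s * n + r) / fps_nth (coeff (B r) (d r)) (s * d r + r)"
        \<comment> \<open>Multiplication by t^(s k) in degree k raises the degree by k and the order
          by s k, so r is kept and the leading terms cancel.\<close>
        define M where "M = monom (fps_const \<mu> * fps_X ^ (s * k)) k"
        have M: "M \<in> Rees" unfolding M_def by (rule Rees_monom[OF X_power_s_mem])
        define P' where "P' = P + (- M) * B r"
        have "P' \<in> Rees"
          unfolding P'_def using less.prems BLT M by (intro Rees_add Rees_mult Rees_uminus) simp_all
        moreover have "proj P' \<in> J"
          unfolding P'_def using less.prems BLT M by (intro combine[OF assms] Rees_uminus) simp_all
        ultimately have P': "P' \<in> Rees" "proj P' \<in> J" .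
        have coeff_M: "coeff (M * B r) m = (if m < k then 0 else fps_const \<mu> * fps_X ^ (s * k) * coeff (B r) (m - k))" for m
          unfolding M_def by (simp add: coeff_monom_mult)
        have "proj P' \<in> Idl\<^bsub>G\<^esub> S"
        proof (rule less.hyps[of n "Suc r"])
          show "\<forall>m>n. coeff P' m = 0" using less.prems(3) BLT by (auto simp: P'_def coeff_M n)
          show "\<forall>j<s * n + Suc r. fps_nth (coeff P' n) j = 0"
          proof (intro allI impI)
            fix j assume j: "j < s * n + Suc r"
            have eq: "fps_nth (coeff P' n) j = fps_nth (coeff P n) j -
                \<mu> * (if j < s * k then 0 else fps_nth (coeff (B r) (d r)) (j - s * k))"
              by (simp add: P'_def coeff_M n fps_X_power_mult_nth mult.assoc)
            have sn: "s * n = s * k + s * d r" by (simp add: n distrib_left)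
            show "fps_nth (coeff P' n) j = 0"
            proof (cases "j = s * n + r")
              case True
              then show ?thesis using BLT unfolding eq by (simp add: \<mu>_def sn)
            next
              case False
              then have "j < s * n + r" using j by simp
              moreover from this have "\<not> j < s * k \<Longrightarrow> j - s * k < s * d r + r" using sn by simp
              ultimately show ?thesis using BLT less.prems(4) unfolding eq by simp
            qed
          qed
        qed (use P' r in auto)
        moreover have "proj (B r) \<in> Idl\<^bsub>G\<^esub> S"
          using G.genideal_self[OF S_carrier] \<open>r \<in> R\<close> by (auto simp: S_def)
        ultimately have "proj (P' + M * B r) \<in> Idl\<^bsub>G\<^esub> S"
          using BLT P' M by (intro combine I.is_ideal) auto
        then show ?thesis by (simp add: P'_def)
      qed
    qed
  qed
  have "J \<subseteq> Idl\<^bsub>G\<^esub> S"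
  proof
    fix x assume "x \<in> J"
    moreover from this obtain P where "P \<in> Rees" "x = proj P"
      using J.a_subset by (auto elim!: carrier_obtain)
    ultimately show "x \<in> Idl\<^bsub>G\<^esub> S"
      using gen[of P "degree P" 0] Ipow_nth_eq_0[OF ReesD[of P]] by (simp add: coeff_eq_0)
  qed
  moreover have "Idl\<^bsub>G\<^esub> S \<subseteq> J" by (rule G.genideal_minimal[OF assms \<open>S \<subseteq> J\<close>])
  ultimately show ?thesis using S_carrier \<open>finite S\<close> by blast
qed

lemma cohen_macaulay_G: "cohen_macaulay (G :: (nat \<Rightarrow> 'k::field fps set) ring)"
proof -
  interpret nilpotent_over_poly "G :: (nat \<Rightarrow> 'k fps set) ring" "\<phi> :: _ \<Rightarrow> 'k poly" "s + c"
    by (rule nilpotent_over_poly_G)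
  show ?thesis by (rule cohen_macaulay[OF noetherian_ringI[OF ideal_G_finitely_generated]])
qed

end

section \<open>Quasi-socle ideals of semigroup rings\<close>

text \<open>The least positive difference d of two elements of H divides every element of H, so gcd
  1 gives d = 1. Two consecutive elements x, x + 1 then generate all integers from x^2 on.\<close>

lemma exists_conductor:
  fixes H :: "nat set"
  assumes zero: "0 \<in> H" and add: "\<And>x y. x \<in> H \<Longrightarrow> y \<in> H \<Longrightarrow> x + y \<in> H" and "Gcd H = 1"
  shows "\<exists>m. \<forall>n\<ge>m. n \<in> H"
proof -
  have mult: "k * x \<in> H" if "x \<in> H" for k x
    by (induction k) (use that zero add in auto)
  define D where "D d \<longleftrightarrow> 0 < d \<and> (\<exists>x\<in>H. x + d \<in> H)" for d
  obtain h where "h \<in> H" "h \<noteq> 0"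
    using assms(3) Gcd_0_iff[of H] by auto
  then have "D h" using zero by (auto simp: D_def intro!: bexI[of _ 0])
  define d where "d = (LEAST d. D d)"
  have "D d" unfolding d_def using \<open>D h\<close> by (rule LeastI)
  then obtain x where x: "0 < d" "x \<in> H" "x + d \<in> H" by (auto simp: D_def)
  have "d dvd y" if "y \<in> H" for y
  proof (rule ccontr)
    assume "\<not> d dvd y"
    then have "0 < y mod d" by (simp add: dvd_eq_mod_eq_0)
    \<comment> \<open>This exhibits \<open>y mod d\<close> as a difference of two elements of
      H.\<close>
    have "(y div d) * (x + d) + y mod d = (y div d) * x + y"
      by (simp add: distrib_left add.assoc)
    then have "D (y mod d)"
      using \<open>0 < y mod d\<close> mult[OF x(3), of "y div d"] add[OF mult[OF x(2), of "y div d"] that]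
      unfolding D_def by metis
    then have "d \<le> y mod d" unfolding d_def by (rule Least_le)
    then show False using mod_less_divisor[OF x(1), of y] by simp
  qed
  then have "d dvd Gcd H" by (rule Gcd_greatest)
  then have x1: "x + 1 \<in> H" using x(3) assms(3) by simp
  have "n \<in> H" if "x * x \<le> n" for n
  proof (cases "x = 0")
    case True
    then show ?thesis using mult[OF x1, of n] by simp
  next
    case False
    then have le: "n mod x \<le> n div x"
      using that by (metis div_le_mono le_trans less_imp_le mod_less_divisor neq0_conv nonzero_mult_div_cancel_left)
    \<comment> \<open>Since n mod x \<le> n div x, the first factor is not truncated.\<close>
    have "n = (n div x - n mod x) * x + (n mod x) * (x + 1)"
    proof -
      have "(n div x - n mod x) * x + (n mod x) * x = (n div x) * x"
        using le by (simp flip: distrib_right)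
      then show ?thesis using div_mult_mod_eq[of n x] unfolding distrib_left by linarith
    qed
    then show ?thesis using add[OF mult[OF x(2)] mult[OF x1]] by metis
  qed
  then show ?thesis by blast
qed

lemma (in quasi_socle) shifted_sg_ideal_E:
  assumes "a * (q - 1) \<le> s"
  shows "shifted_sg_ideal H c E s"
  by unfold_locales (use E_ideal s_mem_E E_ge s_pos shift_mem_E_pow[OF assms] in auto)

theorem theorem2p1:
  fixes a :: "nat \<Rightarrow> nat" and l c q s :: nat and H :: "nat set"
    and A :: "('k::field) fps ring" and \<mm> Q I :: "'k fps set"
  assumes "l \<ge> 1" and "0 < a 1" and "strict_mono_on {1..l} a" and "Gcd (a ` {1..l}) = 1"
    and "H = num_semigroup a l" and "c = conductor H"
    and "A = semigroup_ring H" and "\<mm> = Idl\<^bsub>A\<^esub> {fps_X ^ a i |i. i \<in> {1..l}}"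
    and "gorenstein_local A"
    and "q > 0"
    and "\<forall>n\<ge>c. fps_X ^ n \<in> ideal_pow A \<mm> q"
    and "\<forall>n\<in>H. fps_X ^ n \<notin> ideal_pow A \<mm> (q - 1) \<longrightarrow> n < a 1 * (q - 1)"
    and "0 < s" and "s \<in> H"
    and "Q = PIdl\<^bsub>A\<^esub> (fps_X ^ s)" and "I = colon_ideal A Q (ideal_pow A \<mm> q)"
  shows "(ideal_pow A \<mm> q \<cdot>\<^bsub>A\<^esub> I = ideal_pow A \<mm> q \<cdot>\<^bsub>A\<^esub> Q \<and>
          Q \<inter> ideal_pow A I 2 = Q \<cdot>\<^bsub>A\<^esub> I) \<and>
         (s \<ge> c \<longrightarrow> ideal_pow A I 2 = Q \<cdot>\<^bsub>A\<^esub> I) \<and>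
         (s \<ge> a 1 * (q - 1) \<longrightarrow>
            ideal_pow A I 3 = Q \<cdot>\<^bsub>A\<^esub> ideal_pow A I 2 \<and> cohen_macaulay (assoc_graded A I))"
proof -
  have mem_H: "n \<in> H \<longleftrightarrow> (\<exists>\<alpha>. n = (\<Sum>i=1..l. \<alpha> i * a i))" for n
    by (simp add: \<open>H = _\<close> num_semigroup_def)
  have zero: "0 \<in> H" unfolding mem_H by (rule exI[of _ "\<lambda>_. 0"]) simp
  have add: "x + y \<in> H" if xy: "x \<in> H" "y \<in> H" for x y
  proof -
    from xy obtain \<alpha> \<beta> where "x = (\<Sum>i=1..l. \<alpha> i * a i)" "y = (\<Sum>i=1..l. \<beta> i * a i)"
      unfolding mem_H by blast
    then show ?thesis
      unfolding mem_H by (intro exI[of _ "\<lambda>i. \<alpha> i + \<beta> i"]) (simp add: sum.distrib distrib_right)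
  qed
  have a_pos: "0 < a i" and a_ge: "a 1 \<le> a i" if i: "i \<in> {1..l}" for i
  proof -
    show "a 1 \<le> a i"
      using strict_mono_on_leD[OF assms(3), of 1 i] i assms(1) by auto
    then show "0 < a i" using assms(2) by simp
  qed
  \<comment> \<open>Links the generators of the maximal ideal to all of \<open>H - {0}\<close>, and
    shows that no positive element of H is below a_1.\<close>
  have generator: "\<exists>i\<in>{1..l}. \<exists>h\<in>H. n = a i + h" if n: "n \<in> H" "n \<noteq> 0" for n
  proof -
    obtain \<alpha> where \<alpha>: "n = (\<Sum>i=1..l. \<alpha> i * a i)" using n(1) unfolding mem_H by blast
    then obtain i where i: "i \<in> {1..l}" "\<alpha> i * a i \<noteq> 0"
      using n(2) by (meson sum.neutral)
    \<comment> \<open>One copy of \<open>a i\<close> is taken out of the representation.\<close>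
    define \<beta> where "\<beta> = \<alpha>(i := \<alpha> i - 1)"
    have "n = \<alpha> i * a i + (\<Sum>j\<in>{1..l} - {i}. \<alpha> j * a j)"
      unfolding \<alpha> by (rule sum.remove) (use i in auto)
    also have "\<alpha> i * a i = a i + \<beta> i * a i" using i by (cases "\<alpha> i") (simp_all add: \<beta>_def)
    also have "(\<Sum>j\<in>{1..l} - {i}. \<alpha> j * a j) = (\<Sum>j\<in>{1..l} - {i}. \<beta> j * a j)"
      by (rule sum.cong) (auto simp: \<beta>_def)
    also have "a i + \<beta> i * a i + \<dots> = a i + (\<Sum>j=1..l. \<beta> j * a j)"
      using i by (simp add: sum.remove[of _ i])
    finally show ?thesis using i(1) mem_H by blast
  qed
  have a_mem: "a i \<in> H" if i: "i \<in> {1..l}" for i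
    unfolding mem_H using i by (intro exI[of _ "\<lambda>j. if j = i then 1 else 0"]) (simp add: if_distrib[of "\<lambda>x. x * _"] cong: if_cong)
  have "Gcd H dvd Gcd (a ` {1..l})" by (rule Gcd_greatest) (metis Gcd_dvd a_mem imageE)
  then have "Gcd H = 1" using assms(4) by simp
  then have ex: "\<exists>m. \<forall>n\<ge>m. n \<in> H" using exists_conductor zero add by blast
  have c: "\<forall>n\<ge>c. n \<in> H" unfolding \<open>c = _\<close> conductor_def by (rule LeastI_ex[OF ex])
  interpret numerical_semigroup H c by unfold_locales (use zero add c in auto)
  have frobenius: "n \<notin> H" if "Suc n = c" for n
  proof
    assume "n \<in> H"
    then have "\<forall>m\<ge>n. m \<in> H" using c that by (metis Suc_leI le_neq_implies_less)
    then have "c \<le> n" unfolding \<open>c = _\<close> conductor_def by (rule Least_le)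
    then show False using that by simp
  qed
  have m: "\<mm> = supp_on (H - {0})"
  proof
    interpret A: cring A unfolding \<open>A = _\<close> by (rule cring_A)
    have gens: "{fps_X ^ a i |i. i \<in> {1..l}} \<subseteq> supp_on (H - {0})"
      using a_mem a_pos by fastforce
    have id: "ideal (supp_on (H - {0})) A" unfolding \<open>A = _\<close> by (intro ideal_supp_on sg_ideal_pos)
    then have carr: "{fps_X ^ a i |i. i \<in> {1..l}} \<subseteq> carrier A"
      using gens supp_on_mono[of "H - {0}" H] unfolding \<open>A = _\<close> by auto
    show "\<mm> \<subseteq> supp_on (H - {0})"
      unfolding \<open>\<mm> = _\<close> by (rule A.genideal_minimal[OF id gens])
    have "ideal \<mm> A" unfolding \<open>\<mm> = _\<close> by (rule A.genideal_ideal[OF carr])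
    show "supp_on (H - {0}) \<subseteq> \<mm>"
    proof (rule supp_on_subset_ideal)
      show "ideal \<mm> (semigroup_ring H)" using \<open>ideal \<mm> A\<close> by (simp add: \<open>A = _\<close>)
      fix n assume "n \<in> H - {0}"
      then obtain i h where ih: "i \<in> {1..l}" "h \<in> H" "n = a i + h" using generator by blast
      have "fps_X ^ a i \<in> \<mm>" unfolding \<open>\<mm> = _\<close> using A.genideal_self[OF carr] ih(1) by blast
      then have "fps_X ^ a i \<otimes>\<^bsub>A\<^esub> fps_X ^ h \<in> \<mm>"
        using ih(2) by (intro ideal.I_r_closed[OF \<open>ideal \<mm> A\<close>]) (simp_all add: \<open>A = _\<close>)
      then show "fps_X ^ n \<in> \<mm>" by (simp add: \<open>A = _\<close> ih(3) power_add)
    qed blast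
  qed
  have pow_m: "ideal_pow A \<mm> n = supp_on (sg_pow (H - {0}) n)" for n
    unfolding m \<open>A = _\<close> by (rule ideal_pow_supp_on[OF sg_ideal_pos])
  have symmetric: "\<exists>h\<in>H. Suc (n + h) = c" if "n \<notin> H" for n
    using gorenstein_imp_symmetric[OF assms(9)[unfolded \<open>A = _\<close>] frobenius that] .
  \<comment> \<open>A monomial lies in a monomial ideal iff its exponent lies in the exponent set,
    which turns (i) and (ii) into statements on \<open>sg_pow\<close>.\<close>
  interpret quasi_socle H c "a 1" q s
  proof
    show "a 1 \<le> h" if "h \<in> H" "h \<noteq> 0" for h
      using generator[OF that] a_ge by (metis le_add1 le_trans)
    show "n \<in> sg_pow (H - {0}) q" if "c \<le> n" for n
      using assms(11) that by (simp add: pow_m)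
    show "n < a 1 * (q - 1)" if "n \<in> H" "n \<notin> sg_pow (H - {0}) (q - 1)" for n
      using assms(12) that by (simp add: pow_m)
  qed (use frobenius symmetric assms in auto)
  have Q: "Q = supp_on ({s} + H)"
    unfolding \<open>Q = _\<close> \<open>A = _\<close> by (rule PIdl_X_power[OF \<open>s \<in> H\<close>])
  have I: "I = supp_on E"
    unfolding \<open>I = _\<close> Q pow_m unfolding \<open>A = _\<close> E_def by (rule colon_ideal_supp_on[OF Hq_ideal])
  have pow_I: "ideal_pow A I n = supp_on (sg_pow E n)" for n
    unfolding I \<open>A = _\<close> by (rule ideal_pow_supp_on[OF E_ideal])
  \<comment> \<open>The summand H in the exponents of Q is absorbed by the ideal F.\<close>
  have Q_times: "Q \<cdot>\<^bsub>A\<^esub> supp_on F = supp_on ({s} + F)" if "sg_ideal F" for F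
    unfolding Q \<open>A = _\<close> ideal_prod_supp_on[OF sg_ideal_shift[OF \<open>s \<in> H\<close>] that]
    by (simp add: add.assoc add.commute[of H] sg_ideal_add_H[OF that])
  have QI: "Q \<cdot>\<^bsub>A\<^esub> I = supp_on ({s} + E)"
    unfolding I by (rule Q_times[OF E_ideal])
  have 1: "ideal_pow A \<mm> q \<cdot>\<^bsub>A\<^esub> I = ideal_pow A \<mm> q \<cdot>\<^bsub>A\<^esub> Q"
    unfolding pow_m I Q unfolding \<open>A = _\<close> ideal_prod_supp_on[OF Hq_ideal E_ideal]
      ideal_prod_supp_on[OF Hq_ideal sg_ideal_shift[OF \<open>s \<in> H\<close>]] Hq_plus_E ..
  have Int: "({s} + H) \<inter> (E + E) = {s} + E"
  proof
    show "({s} + H) \<inter> (E + E) \<subseteq> {s} + E"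
    proof
      fix x assume "x \<in> ({s} + H) \<inter> (E + E)"
      then obtain h where "h \<in> H" "x = s + h" "s + h \<in> E + E" by (auto simp: set_plus_iff[of _ "{s}"])
      then show "x \<in> {s} + E" using shift_mem_E_plus_E by (auto simp: set_plus_iff[of _ "{s}"])
    qed
    have "s + e \<in> {s} + H" "s + e \<in> E + E" if "e \<in> E" for e
      using that s_mem_E E_subset by (auto simp only: set_plus_iff)
    then show "{s} + E \<subseteq> ({s} + H) \<inter> (E + E)" by (auto simp: set_plus_iff)
  qed
  have 2: "Q \<inter> ideal_pow A I 2 = Q \<cdot>\<^bsub>A\<^esub> I"
    unfolding QI unfolding pow_I Q supp_on_Int E_pow_2 Int ..
  have 3: "ideal_pow A I 2 = Q \<cdot>\<^bsub>A\<^esub> I" if large: "c \<le> s"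
  proof -
    have "E + E \<subseteq> {s} + H"
    proof
      fix x assume "x \<in> E + E"
      then obtain h where "h \<in> H" "x = s + h" by (rule E_plus_E_if_large[OF large])
      then show "x \<in> {s} + H" by (auto simp: set_plus_iff)
    qed
    \<comment> \<open>Once E + E lies in s + H, the intersection formula of (1) is already the
      claim.\<close>
    then have "E + E = {s} + E" using Int by (simp only: Int_absorb1)
    then show ?thesis unfolding QI unfolding pow_I E_pow_2 by (rule arg_cong)
  qed
  have 4: "ideal_pow A I 3 = Q \<cdot>\<^bsub>A\<^esub> ideal_pow A I 2" if "a 1 * (q - 1) \<le> s"
    using E_pow_Suc[OF that, of 2] unfolding pow_I Q_times[OF sg_ideal_pow[OF E_ideal]]
    by (simp add: numeral_3_eq_3 numeral_2_eq_2)
  have 5: "cohen_macaulay (assoc_graded A I)" if "a 1 * (q - 1) \<le> s"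
  proof -
    interpret shifted_sg_ideal H c E s by (rule shifted_sg_ideal_E[OF that])
    show ?thesis using cohen_macaulay_G unfolding G_def I \<open>A = _\<close> .
  qed
  show ?thesis using 1 2 3 4 5 by blast
qed

end
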